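(* Let $K$ be a nonempty compact Hausdorff space, let $H$ be a closed subsemigroup of a locally compact group with left-invariant Haar measure $\lambda$, acting on $K$ such that $H\times K\to K$, $(s,x)\mapsto sx$, is continuous, let $\mathcal{S}=\{T_s: s\in H\}$ be the associated Koopman semigroup on $C(K)$, and suppose that $H$ has a Følner sequence $(F_n)_{n\in\mathbb{N}}$. Then the notion of a center of attraction does not depend on the choice of the Følner sequence. Moreover, for a closed non-empty set $L\subset K$ the following assertions are equivalent. (a) $L$ is a center of attraction. (b) $I_L:=\{f\in C(K): f|_L=0\}\subset \mathrm{rad}_{\mathcal{S}}(0)$. In particular, there is a unique minimal (with respect to inclusion) center of attraction $M(\mathcal{S})$, given by the closure of the union of the supports of the ergodic measures, i.e. $M(\mathcal{S})=\mathrm{supp}\,\mathrm{rad}_{\mathcal{S}}(0)$.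
   Context: $C(K)$ is the Banach lattice of continuous complex-valued functions on $K$; its dual $C(K)'$ is identified with the complex regular Borel measures on $K$, with $\langle f,\mu\rangle=\int_K f\,d\mu$. The Koopman operators are $T_sf(x)=f(sx)$ for $f\in C(K)$, $s\in H$, $x\in K$. A Følner sequence for $H$ is a sequence $(F_n)_{n\in\mathbb{N}}$ of compact subsets of $H$ with positive measure such that $\lim_{n\to\infty}\lambda(F_n\Delta sF_n)/\lambda(F_n)=0$ for each $s\in H$. A closed non-empty set $L\subset K$ is a (global) center of attraction (with respect to $(F_n)$) if for each open set $U\supset L$ one has $\lim_{n\to\infty}\frac{1}{\lambda(F_n)}\lambda(\{s\in F_n: sx\in U\})=1$ for every $x\in K$. $P_{\mathcal{S}}(K)$ is the set of probability measures $\mu\in C(K)'$ with $S'\mu=\mu$ for all $S\in\mathcal{S}$. For $\mu\in P_{\mathcal{S}}(K)$, let $I_\mu=\{f\in C(K): \langle |f|,\mu\rangle=0\}$; every $S\in\mathcal{S}$ induces (uniquely, by continuous extension) a bounded operator $S_\mu$ on $L^1(K,\mu)$, and $\mu$ is ergodic if the common fixed space of all $S_\mu$ ($S\in\mathcal{S}$) in $L^1(K,\mu)$ is one-dimensional. The support of a probability measure $\mu\in C(K)'$ is the smallest closed $A\subset K$ with $\mu(A)=1$. $\mathrm{Prim}(\mathcal{S})=\{I_\mu:\mu\in P_{\mathcal{S}}(K)\text{ ergodic}\}$ and $\mathrm{rad}_{\mathcal{S}}(0)=\bigcap_{p\in\mathrm{Prim}(\mathcal{S})}p$. For a closed ideal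 $I\subset C(K)$, $\mathrm{supp}\,I$ denotes the unique closed set $L\subset K$ with $I=I_L$. *)

theory Defs
  imports "HOL-Probability.Probability"
begin

text \<open>
  A topological group is a type of class \<^class>\<open>topological_group_add\<close>. This class is not
  commutative; the product \<open>st\<close> is written \<open>s + t\<close>.
  A compact Hausdorff space \<open>K\<close> is a type of class \<^class>\<open>t2_space\<close> with compact
  universe, and then \<open>C(K)\<close> is the type \<open>'k \<Rightarrow>\<^sub>C complex\<close>, since every continuous
  function on \<open>K\<close> is bounded.
\<close>

type_synonym 'k operator = "('k \<Rightarrow>\<^sub>C complex) \<Rightarrow> ('k \<Rightarrow>\<^sub>C complex)"

subsection \<open>Haar measure and Folner sequences\<close>

definition left_haar_measure :: "'g::topological_group_add measure \<Rightarrow> bool" where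
  "left_haar_measure lam \<longleftrightarrow>
     sets lam = sets borel \<and>
     emeasure lam UNIV \<noteq> 0 \<and>
     (\<forall>C. compact C \<longrightarrow> emeasure lam C < \<infinity>) \<and>
     (\<forall>A\<in>sets borel. emeasure lam A = (INF U\<in>{U. open U \<and> A \<subseteq> U}. emeasure lam U)) \<and>
     (\<forall>U. open U \<longrightarrow> emeasure lam U = (SUP C\<in>{C. compact C \<and> C \<subseteq> U}. emeasure lam C)) \<and>
     (\<forall>g. \<forall>A\<in>sets borel. emeasure lam ((+) g ` A) = emeasure lam A)"

definition folner_sequence ::
    "'g::topological_group_add measure \<Rightarrow> 'g set \<Rightarrow> (nat \<Rightarrow> 'g set) \<Rightarrow> bool" where
  "folner_sequence lam H F \<longleftrightarrow>
     (\<forall>n. compact (F n) \<and> F n \<subseteq> H \<and> measure lam (F n) > 0) \<and>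
     (\<forall>s\<in>H. (\<lambda>n. measure lam (sym_diff (F n) ((+) s ` F n)) / measure lam (F n)) \<longlonglongrightarrow> 0)"

subsection \<open>Semigroup actions and centers of attraction\<close>

text \<open>
  A subsemigroup need not contain the neutral element, so no identity law is imposed.
  Only the values of \<open>act s\<close> for \<open>s \<in> H\<close> are relevant.
\<close>

definition continuous_semigroup_action ::
    "'g::topological_group_add set \<Rightarrow> ('g \<Rightarrow> 'k::topological_space \<Rightarrow> 'k) \<Rightarrow> bool" where
  "continuous_semigroup_action H act \<longleftrightarrow>
     (\<forall>s\<in>H. \<forall>t\<in>H. \<forall>x. act (s + t) x = act s (act t x)) \<and>
     continuous_on (H \<times> UNIV) (\<lambda>(s, x). act s x)"

definition koopman :: "('g \<Rightarrow> 'k \<Rightarrow> 'k) \<Rightarrow> 'g \<Rightarrow> 'k::topological_space operator" where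
  "koopman act s f = Bcontfun (\<lambda>x. apply_bcontfun f (act s x))"

definition koopman_semigroup ::
    "'g set \<Rightarrow> ('g \<Rightarrow> 'k \<Rightarrow> 'k) \<Rightarrow> 'k::topological_space operator set" where
  "koopman_semigroup H act = koopman act ` H"

definition center_of_attraction ::
    "'g measure \<Rightarrow> (nat \<Rightarrow> 'g set) \<Rightarrow> ('g \<Rightarrow> 'k \<Rightarrow> 'k) \<Rightarrow> 'k::topological_space set \<Rightarrow> bool" where
  "center_of_attraction lam F act L \<longleftrightarrow>
     closed L \<and> L \<noteq> {} \<and>
     (\<forall>U. open U \<and> L \<subseteq> U \<longrightarrow>
        (\<forall>x. (\<lambda>n. measure lam {s \<in> F n. act s x \<in> U} / measure lam (F n)) \<longlonglongrightarrow> 1))"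

definition minimal_center_of_attraction ::
    "'g measure \<Rightarrow> (nat \<Rightarrow> 'g set) \<Rightarrow> ('g \<Rightarrow> 'k \<Rightarrow> 'k) \<Rightarrow> 'k::topological_space set \<Rightarrow> bool" where
  "minimal_center_of_attraction lam F act M \<longleftrightarrow>
     center_of_attraction lam F act M \<and>
     (\<forall>L. center_of_attraction lam F act L \<and> L \<subseteq> M \<longrightarrow> L = M)"

subsection \<open>Invariant and ergodic measures\<close>

definition regular_probability_measure :: "'k::topological_space measure \<Rightarrow> bool" where
  "regular_probability_measure \<mu> \<longleftrightarrow>
     prob_space \<mu> \<and> sets \<mu> = sets borel \<and>
     (\<forall>A\<in>sets borel.
        emeasure \<mu> A = (INF U\<in>{U. open U \<and> A \<subseteq> U}. emeasure \<mu> U) \<and>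
        emeasure \<mu> A = (SUP C\<in>{C. compact C \<and> C \<subseteq> A}. emeasure \<mu> C))"

text \<open>The condition \<open>S'\<mu> = \<mu>\<close> is tested against all \<open>f \<in> C(K)\<close>.\<close>

definition invariant_measures ::
    "'k::topological_space operator set \<Rightarrow> 'k measure set" where
  "invariant_measures \<S> =
     {\<mu>. regular_probability_measure \<mu> \<and>
         (\<forall>S\<in>\<S>. \<forall>f. (LINT x|\<mu>. apply_bcontfun (S f) x) = (LINT x|\<mu>. apply_bcontfun f x))}"

text \<open>
  Elements of \<open>L\<^sup>1(K, \<mu>)\<close> are represented by integrable functions, equal almost everywhere
  meaning equal in \<open>L\<^sup>1\<close>. The operator \<open>S\<^sub>\<mu>\<close> is the continuous extension of \<open>S\<close>:
  \<open>S\<^sub>\<mu> f\<close> is the \<open>L\<^sup>1\<close>-limit of \<open>S (h n)\<close>, where \<open>h n \<in> C(K)\<close> tends to \<open>f\<close> in \<open>L\<^sup>1\<close>.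
  If \<open>\<mu>\<close> is invariant under a Koopman operator \<open>S\<close>, then \<open>S\<close> is isometric for the
  \<open>L\<^sup>1\<close>-seminorm, so the chosen representative is determined up to a null set.
\<close>

definition L1_extension ::
    "'k::topological_space measure \<Rightarrow> 'k operator \<Rightarrow> ('k \<Rightarrow> complex) \<Rightarrow> ('k \<Rightarrow> complex)" where
  "L1_extension \<mu> S f =
     (SOME g. integrable \<mu> g \<and>
        (\<exists>h :: nat \<Rightarrow> ('k \<Rightarrow>\<^sub>C complex).
           (\<lambda>n. LINT x|\<mu>. cmod (apply_bcontfun (h n) x - f x)) \<longlonglongrightarrow> 0 \<and>
           (\<lambda>n. LINT x|\<mu>. cmod (apply_bcontfun (S (h n)) x - g x)) \<longlonglongrightarrow> 0))"

definition L1_fixed_space ::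
    "'k::topological_space operator set \<Rightarrow> 'k measure \<Rightarrow> ('k \<Rightarrow> complex) set" where
  "L1_fixed_space \<S> \<mu> =
     {f. integrable \<mu> f \<and> (\<forall>S\<in>\<S>. AE x in \<mu>. L1_extension \<mu> S f x = f x)}"

text \<open>The second condition says that the fixed space modulo null functions has dimension one.\<close>

definition ergodic_measures ::
    "'k::topological_space operator set \<Rightarrow> 'k measure set" where
  "ergodic_measures \<S> =
     {\<mu> \<in> invariant_measures \<S>.
        \<exists>e\<in>L1_fixed_space \<S> \<mu>. \<not> (AE x in \<mu>. e x = 0) \<and>
          (\<forall>f\<in>L1_fixed_space \<S> \<mu>. \<exists>c. AE x in \<mu>. f x = c * e x)}"

definition measure_support :: "'k::topological_space measure \<Rightarrow> 'k set" where
  "measure_support \<mu> = (LEAST A. closed A \<and> emeasure \<mu> A = 1)"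

subsection \<open>Ideals of \<open>C(K)\<close>\<close>

definition measure_ideal :: "'k::topological_space measure \<Rightarrow> ('k \<Rightarrow>\<^sub>C complex) set" where
  "measure_ideal \<mu> = {f. (LINT x|\<mu>. cmod (apply_bcontfun f x)) = 0}"

definition vanishing_ideal :: "'k::topological_space set \<Rightarrow> ('k \<Rightarrow>\<^sub>C complex) set" where
  "vanishing_ideal L = {f. \<forall>x\<in>L. apply_bcontfun f x = 0}"

definition ideal_support :: "('k::topological_space \<Rightarrow>\<^sub>C complex) set \<Rightarrow> 'k set" where
  "ideal_support I = (THE L. closed L \<and> I = vanishing_ideal L)"

definition Prim ::
    "'k::topological_space operator set \<Rightarrow> ('k \<Rightarrow>\<^sub>C complex) set set" where
  "Prim \<S> = measure_ideal ` ergodic_measures \<S>"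

definition radical_zero ::
    "'k::topological_space operator set \<Rightarrow> ('k \<Rightarrow>\<^sub>C complex) set" where
  "radical_zero \<S> = \<Inter> (Prim \<S>)"

end

theory Submission
  imports Defs
begin

text \<open>
  Identify invariant measures with invariant states of \<open>C(K)\<close> by the Riesz representation theorem.
  A closed set \<open>L\<close> is a center of attraction iff every invariant state vanishes on the nonnegative
  functions that are zero on \<open>L\<close>: if \<open>L\<close> is a center, the Folner averages of such a function tend to
  zero pointwise while their integral against an invariant measure is constant; if \<open>L\<close> is not a
  center, a weak-* cluster point of the averages at a bad point is an invariant state that does
  not vanish. The invariant states form a compact set, and for each \<open>f\<close> some extreme invariant
  state maximizes \<open>f\<close>; extreme invariant states are ergodic, so it suffices to look
  at ergodic measures, and the condition becomes that \<open>L\<close> contains all their supports. No Folner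
  sequence occurs in that condition.
\<close>

section \<open>The Riesz representation theorem\<close>

text \<open>\<open>K\<close> is an arbitrary compact Hausdorff space, and this shapes the argument.
  A sequence of states need not have a convergent subsequence, so limits are taken along cluster
  filters. A Borel measure need not be regular, so regularity is carried along as the source of
  every approximation by continuous functions. The Borel sets of a product may exceed the product
  sigma-algebra, so averaging over the group and integrating over \<open>K\<close> are interchanged
  through uniform approximation by finite combinations of translates. States are functionals on all
  of \<open>'k \<Rightarrow> real\<close>, so that the weak-* topology is the product topology,
  compactness is Tychonoff's theorem, and the Krein-Milman argument runs on coordinates. Since
  nonnegative functions are tested one at a time, it is enough to dominate the value of a state at a
  single function by an ergodic integral.\<close>

lemma compact_t2_Urysohn:
  fixes S T :: "'k::t2_space set"
  assumes "compact (UNIV :: 'k set)" "closed S" "closed T" "S \<inter> T = {}"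
  obtains h :: "'k \<Rightarrow> real" where "continuous_on UNIV h" "\<And>x. 0 \<le> h x" "\<And>x. h x \<le> 1"
    "\<And>x. x \<in> S \<Longrightarrow> h x = 0" "\<And>x. x \<in> T \<Longrightarrow> h x = 1"
proof -
  have "normal_space (euclidean :: 'k topology)"
    using assms(1) by (intro compact_Hausdorff_or_regular_imp_normal_space)
      (auto simp: compact_space_def Hausdorff_space_def disjnt_def intro!: hausdorff[simplified])
  then obtain h where "continuous_map (euclidean :: 'k topology) (top_of_set {0..1::real}) h"
    "h ` S \<subseteq> {0}" "h ` T \<subseteq> {1}"
    using Urysohn_lemma[of euclidean S T 0 1] assms by (auto simp: disjnt_def)
  then show thesis
    by (intro that[of h]) (auto simp: continuous_map_in_subtopology image_subset_iff)
qed

text \<open>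
  Functionals on \<open>C(K)\<close> take the value 0 at discontinuous functions, so that a state is determined by
  its values on \<open>C(K)\<close> and the set of states is closed in a product of compact intervals.
\<close>

definition state :: "(('k::topological_space \<Rightarrow> real) \<Rightarrow> real) \<Rightarrow> bool" where
  "state \<phi> \<longleftrightarrow>
     (\<forall>f g. continuous_on UNIV f \<longrightarrow> continuous_on UNIV g \<longrightarrow> \<phi> (\<lambda>x. f x + g x) = \<phi> f + \<phi> g) \<and>
     (\<forall>c f. continuous_on UNIV f \<longrightarrow> \<phi> (\<lambda>x. c * f x) = c * \<phi> f) \<and>
     (\<forall>f. continuous_on UNIV f \<longrightarrow> (\<forall>x. 0 \<le> f x) \<longrightarrow> 0 \<le> \<phi> f) \<and>
     \<phi> (\<lambda>x. 1) = 1 \<and>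
     (\<forall>f. \<not> continuous_on UNIV f \<longrightarrow> \<phi> f = 0)"

locale state_on_compact =
  fixes \<phi> :: "('k::t2_space \<Rightarrow> real) \<Rightarrow> real"
  assumes compact_UNIV: "compact (UNIV :: 'k set)" and state: "state \<phi>"
begin

lemma add: "continuous_on UNIV f \<Longrightarrow> continuous_on UNIV g \<Longrightarrow> \<phi> (\<lambda>x. f x + g x) = \<phi> f + \<phi> g"
  and scale: "continuous_on UNIV f \<Longrightarrow> \<phi> (\<lambda>x. c * f x) = c * \<phi> f"
  and nonneg: "continuous_on UNIV f \<Longrightarrow> (\<And>x. 0 \<le> f x) \<Longrightarrow> 0 \<le> \<phi> f"
  and one: "\<phi> (\<lambda>x. 1) = 1"
  using state by (auto simp: state_def)

lemma const: "\<phi> (\<lambda>x. c) = c"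
  using scale[of "\<lambda>x. 1" c] one by simp

lemma diff:
  assumes "continuous_on UNIV f" "continuous_on UNIV g"
  shows "\<phi> (\<lambda>x. f x - g x) = \<phi> f - \<phi> g"
  using add[of f "\<lambda>x. (-1) * g x"] scale[of g "-1"] assms by (simp add: continuous_on_minus)

lemma mono:
  assumes "continuous_on UNIV f" "continuous_on UNIV g" "\<And>x. f x \<le> g x"
  shows "\<phi> f \<le> \<phi> g"
  using nonneg[of "\<lambda>x. g x - f x"] diff[of g f] assms by (simp add: continuous_on_diff)

lemma sum:
  assumes "finite I" "\<And>i. i \<in> I \<Longrightarrow> continuous_on UNIV (f i)"
  shows "\<phi> (\<lambda>x. \<Sum>i\<in>I. f i x) = (\<Sum>i\<in>I. \<phi> (f i))"
  using assms
proof (induction I rule: finite_induct)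
  case empty
  then show ?case using const[of 0] by simp
next
  case (insert i I)
  then show ?case using add[of "f i" "\<lambda>x. \<Sum>i\<in>I. f i x"] by (simp add: continuous_on_sum)
qed

section \<open>The outer measure attached to a state\<close>

definition below :: "'k set \<Rightarrow> ('k \<Rightarrow> real) set" where
  "below U = {f. continuous_on UNIV f \<and> (\<forall>x. 0 \<le> f x \<and> f x \<le> 1) \<and> (\<forall>x. x \<notin> U \<longrightarrow> f x = 0)}"

definition mass :: "'k set \<Rightarrow> ennreal" where
  "mass U = (SUP f\<in>below U. ennreal (\<phi> f))"

definition outer :: "'k set \<Rightarrow> ennreal" where
  "outer A = (INF U\<in>{U. open U \<and> A \<subseteq> U}. mass U)"

lemma zero_below: "(\<lambda>x. 0) \<in> below U"
  by (simp add: below_def)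

lemma below_le_mass: "f \<in> below U \<Longrightarrow> ennreal (\<phi> f) \<le> mass U"
  unfolding mass_def by (rule SUP_upper)

lemma mass_mono: "U \<subseteq> V \<Longrightarrow> mass U \<le> mass V"
  unfolding mass_def by (rule SUP_subset_mono) (auto simp: below_def)

lemma mass_empty: "mass {} = 0"
proof -
  have "below {} = {\<lambda>x. 0}"
    by (auto simp: below_def)
  then show ?thesis using const[of 0] by (simp add: mass_def)
qed

lemma mass_UNIV: "mass UNIV = 1"
proof (rule antisym)
  show "mass UNIV \<le> 1"
    unfolding mass_def
  proof (rule SUP_least)
    fix f assume "f \<in> below UNIV"
    then have "\<phi> f \<le> 1" using mono[of f "\<lambda>x. 1"] one by (simp add: below_def)
    then show "ennreal (\<phi> f) \<le> 1" by simp
  qed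
  show "1 \<le> mass UNIV"
    using below_le_mass[of "\<lambda>x. 1" UNIV] one by (simp add: below_def)
qed

text \<open>Members of \<open>below U\<close> only vanish off \<open>U\<close>, which is weaker than
  having support inside \<open>U\<close>. Cutting at height \<open>e\<close> repairs this: what
  survives lives on the closed, hence compact, set \<open>{x. e \<le> f x}\<close>, and
  \<open>\<phi>\<close> loses at most \<open>e\<close>.\<close>

lemma truncate:
  assumes "f \<in> below U" "0 < e"
  shows "(\<lambda>x. max 0 (f x - e)) \<in> below U" "\<phi> f \<le> \<phi> (\<lambda>x. max 0 (f x - e)) + e"
    "closed {x. e \<le> f x}" "{x. e \<le> f x} \<subseteq> U"
proof -
  have c: "continuous_on UNIV f" using assms by (simp add: below_def)
  have c': "continuous_on UNIV (\<lambda>x. max 0 (f x - e))"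
    using c by (intro continuous_intros)
  have "f x - e \<le> 1" for x using assms by (auto simp: below_def intro: order_trans[of _ "f x"])
  then show "(\<lambda>x. max 0 (f x - e)) \<in> below U" using assms c'
    by (auto simp: below_def)
  have "\<phi> f \<le> \<phi> (\<lambda>x. max 0 (f x - e) + e)"
    using c by (intro mono continuous_intros) auto
  then show "\<phi> f \<le> \<phi> (\<lambda>x. max 0 (f x - e)) + e"
    using add[OF c', of "\<lambda>x. e"] const[of e] by simp
  show "closed {x. e \<le> f x}"
    using c by (intro closed_Collect_le continuous_on_const)
  show "{x. e \<le> f x} \<subseteq> U"
    using assms by (force simp: below_def)
qed

lemma below_mult:
  assumes "f \<in> below U" "continuous_on UNIV h" "\<And>x. 0 \<le> h x" "\<And>x. h x \<le> 1"
    "\<And>x. x \<notin> V \<Longrightarrow> f x = 0 \<or> h x = 0"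
  shows "(\<lambda>x. f x * h x) \<in> below V"
  using assms by (auto simp: below_def mult_le_one intro!: continuous_on_mult)

text \<open>A partition of unity with two members. As \<open>C \<subseteq> U \<union> V\<close>, the
  closed sets \<open>C - U\<close> and \<open>C - V\<close> are disjoint; a Urysohn function
  \<open>h\<close> for them splits the truncated \<open>g\<close> into \<open>g * h\<close>, which
  lives on \<open>U\<close>, and \<open>g * (1 - h)\<close>, which lives on
  \<open>V\<close>.\<close>

lemma mass_Un:
  assumes "open U" "open V"
  shows "mass (U \<union> V) \<le> mass U + mass V"
  unfolding mass_def[of "U \<union> V"]
proof (rule SUP_least, rule ennreal_le_epsilon)
  fix f and e :: real assume f: "f \<in> below (U \<union> V)" and e: "0 < e"
  define C where "C = {x. e \<le> f x}"
  define g where "g = (\<lambda>x. max 0 (f x - e))"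
  note tr = truncate[OF f e, folded C_def g_def]
  have g0: "g x = 0" if "x \<notin> C" for x using that by (auto simp: g_def C_def)
  have "closed (C - U)" "closed (C - V)" "(C - U) \<inter> (C - V) = {}"
    using tr assms by auto
  then obtain h :: "'k \<Rightarrow> real" where h: "continuous_on UNIV h" "\<And>x. 0 \<le> h x" "\<And>x. h x \<le> 1"
    "\<And>x. x \<in> C - U \<Longrightarrow> h x = 0" "\<And>x. x \<in> C - V \<Longrightarrow> h x = 1"
    using compact_t2_Urysohn[OF compact_UNIV, of "C - U" "C - V"] by metis
  have 1: "(\<lambda>x. g x * h x) \<in> below U"
    by (rule below_mult[OF tr(1) h(1-3)]) (use g0 h(4) in blast)
  have 2: "(\<lambda>x. g x * (1 - h x)) \<in> below V"
  proof (rule below_mult[OF tr(1)])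
    show "continuous_on UNIV (\<lambda>x. 1 - h x)" using h(1) by (intro continuous_intros)
    show "g x = 0 \<or> 1 - h x = 0" if "x \<notin> V" for x using g0 h(5)[of x] that by auto
  qed (use h in auto)
  have "\<phi> (\<lambda>x. g x * h x + g x * (1 - h x)) = \<phi> (\<lambda>x. g x * h x) + \<phi> (\<lambda>x. g x * (1 - h x))"
    using 1 2 by (intro add) (auto simp: below_def)
  moreover have "(\<lambda>x. g x * h x + g x * (1 - h x)) = g" by (auto simp: algebra_simps)
  ultimately have eq: "\<phi> g = \<phi> (\<lambda>x. g x * h x) + \<phi> (\<lambda>x. g x * (1 - h x))" by simp
  have nn: "0 \<le> \<phi> (\<lambda>x. g x * h x)" "0 \<le> \<phi> (\<lambda>x. g x * (1 - h x))"
    using 1 2 by (auto simp: below_def intro!: nonneg)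
  have "ennreal (\<phi> f) \<le> ennreal (\<phi> g + e)" using tr(2) by (rule ennreal_leI)
  also have "\<dots> = ennreal (\<phi> (\<lambda>x. g x * h x)) + ennreal (\<phi> (\<lambda>x. g x * (1 - h x))) + ennreal e"
    using nn e by (simp add: eq)
  also have "\<dots> \<le> mass U + mass V + ennreal e"
    using below_le_mass[OF 1] below_le_mass[OF 2] by (intro add_mono) auto
  finally show "ennreal (\<phi> f) \<le> mass U + mass V + ennreal e" .
qed

lemma mass_UN_finite:
  assumes "\<And>i::nat. open (U i)"
  shows "mass (\<Union>i<n. U i) \<le> (\<Sum>i<n. mass (U i))"
proof (induction n)
  case 0
  then show ?case by (simp add: mass_empty)
next
  case (Suc n)
  have "mass (\<Union>i<Suc n. U i) = mass (U n \<union> (\<Union>i<n. U i))"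
    by (simp add: lessThan_Suc)
  also have "\<dots> \<le> mass (U n) + mass (\<Union>i<n. U i)"
    using assms by (intro mass_Un) auto
  finally show ?case using Suc by (simp add: add.commute add_left_mono order_trans)
qed

text \<open>A truncated test function lives on a compact set, which finitely many of the
  \<open>U i\<close> cover; finite subadditivity then suffices.\<close>

lemma mass_UN:
  assumes "\<And>i::nat. open (U i)"
  shows "mass (\<Union>i. U i) \<le> (\<Sum>i. mass (U i))"
  unfolding mass_def[of "\<Union>i. U i"]
proof (rule SUP_least, rule ennreal_le_epsilon)
  fix f and e :: real assume f: "f \<in> below (\<Union>i. U i)" and e: "0 < e"
  define C where "C = {x. e \<le> f x}"
  define g where "g = (\<lambda>x. max 0 (f x - e))"
  note tr = truncate[OF f e, folded C_def g_def]
  have "compact C"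
    using compact_UNIV tr(3) by (metis compact_Int_closed inf_top_left)
  then obtain J where J: "finite J" "C \<subseteq> (\<Union>i\<in>J. U i)"
    using compactE_image[of C UNIV U] assms tr(4) by auto
  obtain n where n: "J \<subseteq> {..<n}" using finite_nat_bounded[OF J(1)] by blast
  have gb: "g \<in> below (\<Union>i<n. U i)"
  proof -
    have "g x = 0" if "x \<notin> (\<Union>i<n. U i)" for x
    proof -
      have "x \<notin> C" using that J(2) n by blast
      then show ?thesis by (auto simp: g_def C_def)
    qed
    then show ?thesis using tr(1) by (auto simp: below_def)
  qed
  have "0 \<le> \<phi> g" using gb by (auto simp: below_def intro: nonneg)
  have "ennreal (\<phi> f) \<le> ennreal (\<phi> g + e)" using tr(2) by (rule ennreal_leI)
  also have "\<dots> = ennreal (\<phi> g) + ennreal e" using \<open>0 \<le> \<phi> g\<close> e by simp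
  also have "ennreal (\<phi> g) \<le> (\<Sum>i<n. mass (U i))"
    using below_le_mass[OF gb] mass_UN_finite[of U n] assms by (meson order_trans)
  also have "\<dots> \<le> (\<Sum>i. mass (U i))" by (rule sum_le_suminf) auto
  finally show "ennreal (\<phi> f) \<le> (\<Sum>i. mass (U i)) + ennreal e"
    by (simp add: add_mono)
qed

lemma outer_open: "open U \<Longrightarrow> outer U = mass U"
  unfolding outer_def by (rule antisym) (auto intro!: INF_lower INF_greatest mass_mono)

lemma outer_mono: "A \<subseteq> B \<Longrightarrow> outer A \<le> outer B"
  unfolding outer_def by (rule INF_superset_mono) auto

lemma outer_le_mass: "open U \<Longrightarrow> A \<subseteq> U \<Longrightarrow> outer A \<le> mass U"
  unfolding outer_def by (rule INF_lower) auto

lemma outer_le_1: "outer A \<le> 1"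
  using outer_le_mass[of UNIV A] mass_UNIV by simp

lemma outer_approx:
  assumes "0 < e"
  obtains U where "open U" "A \<subseteq> U" "mass U \<le> outer A + ennreal e"
proof -
  have "outer A < outer A + ennreal e"
    using outer_le_1[of A] assms
    by (cases "outer A" rule: ennreal_cases) (auto simp: ennreal_lessI top_unique simp flip: ennreal_plus)
  then obtain U where "open U" "A \<subseteq> U" "mass U < outer A + ennreal e"
    unfolding outer_def[of A] by (subst (asm) (1) INF_less_iff) auto
  then show thesis using that by (meson less_imp_le)
qed

lemma outer_UN: "outer (\<Union>i::nat. A i) \<le> (\<Sum>i. outer (A i))"
proof (rule ennreal_le_epsilon)
  fix e :: real assume e: "0 < e"
  have "\<forall>i. \<exists>U. open U \<and> A i \<subseteq> U \<and> mass U \<le> outer (A i) + ennreal (e * (1/2)^Suc i)"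
  proof
    fix i :: nat
    have "0 < e * (1/2)^Suc i" using e by simp
    then show "\<exists>U. open U \<and> A i \<subseteq> U \<and> mass U \<le> outer (A i) + ennreal (e * (1/2)^Suc i)"
      using outer_approx[of "e * (1/2)^Suc i" "A i"] by metis
  qed
  then obtain U where U: "\<And>i. open (U i)" "\<And>i. A i \<subseteq> U i"
    "\<And>i. mass (U i) \<le> outer (A i) + ennreal (e * (1/2)^Suc i)" by metis
  have "outer (\<Union>i. A i) \<le> mass (\<Union>i. U i)"
    using U by (intro outer_le_mass) auto
  also have "\<dots> \<le> (\<Sum>i. mass (U i))" using U by (intro mass_UN)
  also have "\<dots> \<le> (\<Sum>i. outer (A i) + ennreal (e * (1/2)^Suc i))"
    using U by (intro suminf_le) auto
  also have "\<dots> = (\<Sum>i. outer (A i)) + (\<Sum>i. ennreal (e * (1/2)^Suc i))"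
    by (rule suminf_add[symmetric]) auto
  also have "(\<Sum>i. ennreal (e * (1/2)^Suc i)) = ennreal e"
  proof (rule suminf_ennreal_eq)
    show "(\<lambda>i. e * (1/2)^Suc i) sums e"
      using sums_mult[OF power_half_series, of e] by simp
  qed (use e in auto)
  finally show "outer (\<Union>i. A i) \<le> (\<Sum>i. outer (A i)) + ennreal e" .
qed

text \<open>This is the Caratheodory condition for open \<open>U\<close>; it is enough to test it on
  open \<open>W\<close> containing \<open>E\<close>. After truncating a test function below
  \<open>W \<inter> U\<close> to \<open>g\<close>, the open set \<open>W - C\<close> contains
  \<open>W - U\<close>, and any test function below \<open>W - C\<close> can be added to
  \<open>g\<close> without exceeding 1, because the two are nowhere both nonzero.\<close>

lemma outer_split_open:
  assumes "open U"
  shows "outer (E \<inter> U) + outer (E - U) \<le> outer E"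
  unfolding outer_def[of E]
proof (rule INF_greatest, clarify)
  fix W assume W: "open W" "E \<subseteq> W"
  have "outer (E \<inter> U) + outer (E - U) \<le> mass (W \<inter> U) + outer (W - U)"
    using W assms by (intro add_mono outer_le_mass outer_mono) auto
  also have "\<dots> \<le> mass W"
    unfolding mass_def[of "W \<inter> U"]
  proof (subst ennreal_SUP_add_left[symmetric])
    show "below (W \<inter> U) \<noteq> {}" using zero_below by blast
    show "(SUP f\<in>below (W \<inter> U). ennreal (\<phi> f) + outer (W - U)) \<le> mass W"
    proof (rule SUP_least, rule ennreal_le_epsilon)
      fix f and e :: real assume f: "f \<in> below (W \<inter> U)" and e: "0 < e"
      define C where "C = {x. e \<le> f x}"
      define g where "g = (\<lambda>x. max 0 (f x - e))"
      note tr = truncate[OF f e, folded C_def g_def]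
      have g: "continuous_on UNIV g" "\<And>x. 0 \<le> g x" "\<And>x. g x \<le> 1" "\<And>x. x \<notin> W \<Longrightarrow> g x = 0"
        using tr(1) by (auto simp: below_def)
      have sum_le: "ennreal (\<phi> g) + mass (W - C) \<le> mass W"
        unfolding mass_def[of "W - C"]
      proof (subst ennreal_SUP_add_right)
        show "below (W - C) \<noteq> {}" using zero_below by blast
        show "(SUP k\<in>below (W - C). ennreal (\<phi> g) + ennreal (\<phi> k)) \<le> mass W"
        proof (rule SUP_least)
          fix k assume k: "k \<in> below (W - C)"
          then have kc: "continuous_on UNIV k" "\<And>x. 0 \<le> k x" "\<And>x. k x \<le> 1"
            "\<And>x. x \<notin> W - C \<Longrightarrow> k x = 0" by (auto simp: below_def)
          have "g x + k x \<le> 1" for x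
          proof (cases "x \<in> C")
            case True
            then show ?thesis using kc(4)[of x] g(3)[of x] by simp
          next
            case False
            then have "g x = 0" by (auto simp: g_def C_def)
            then show ?thesis using kc(3)[of x] by simp
          qed
          then have "(\<lambda>x. g x + k x) \<in> below W"
            using g kc by (auto simp: below_def intro!: continuous_intros)
          moreover have "0 \<le> \<phi> g" "0 \<le> \<phi> k" using g kc by (auto intro: nonneg)
          ultimately show "ennreal (\<phi> g) + ennreal (\<phi> k) \<le> mass W"
            using below_le_mass add[OF g(1) kc(1)] by (metis ennreal_plus)
        qed
      qed
      have "0 \<le> \<phi> g" using g by (auto intro: nonneg)
      have "ennreal (\<phi> f) + outer (W - U) \<le> ennreal (\<phi> g + e) + mass (W - C)"
        using tr W by (intro add_mono ennreal_leI outer_le_mass) (auto simp: open_Diff)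
      also have "\<dots> = ennreal (\<phi> g) + mass (W - C) + ennreal e"
        using \<open>0 \<le> \<phi> g\<close> e by (simp add: ac_simps)
      also have "\<dots> \<le> mass W + ennreal e" using sum_le by (rule add_right_mono)
      finally show "ennreal (\<phi> f) + outer (W - U) \<le> mass W + ennreal e" .
    qed
  qed
  finally show "outer (E \<inter> U) + outer (E - U) \<le> mass W" .
qed

end

lemma compact_continuous_bounded:
  fixes f :: "'k::topological_space \<Rightarrow> real"
  assumes "compact (UNIV :: 'k set)" "continuous_on UNIV f"
  obtains B where "0 < B" "\<And>x. \<bar>f x\<bar> \<le> B"
proof -
  have "bounded (range f)"
    using assms by (intro compact_imp_bounded compact_continuous_image)
  then obtain B where "\<And>x. norm (f x) \<le> B" by (auto simp: bounded_iff)
  then show thesis by (intro that[of "max B 1"]) (auto simp: le_max_iff_disj)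
qed

lemma continuous_integrable:
  fixes f :: "'k::topological_space \<Rightarrow> 'b::{banach, second_countable_topology}"
  assumes "compact (UNIV :: 'k set)" "prob_space \<mu>" "sets \<mu> = sets borel" "continuous_on UNIV f"
  shows "integrable \<mu> f"
proof -
  interpret prob_space \<mu> by fact
  have "bounded (range f)"
    using assms by (intro compact_imp_bounded compact_continuous_image)
  then obtain B where "\<And>x. norm (f x) \<le> B" by (auto simp: bounded_iff)
  moreover have "f \<in> borel_measurable \<mu>"
    using assms by (simp add: borel_measurable_continuous_onI cong: measurable_cong_sets)
  ultimately show ?thesis
    by (intro integrable_const_bound) auto
qed

section \<open>The representing Radon measure\<close>

context state_on_compact
begin

definition radon :: "'k measure" where
  "radon = measure_of UNIV (sets borel) outer"

lemma sets_radon: "sets radon = sets borel"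
  unfolding radon_def by (metis sets.sets_measure_of_eq space_borel)

lemma space_radon: "space radon = UNIV"
  using sets_eq_imp_space_eq[OF sets_radon] by simp

text \<open>Caratheodory's theorem: the sets that split every set additively form a sigma-algebra on
  which \<open>outer\<close> is a measure, and by \<open>outer_split_open\<close> it contains the
  open sets, hence all Borel sets.\<close>

lemma emeasure_radon:
  assumes "A \<in> sets borel"
  shows "emeasure radon A = outer A"
proof -
  let ?L = "lambda_system UNIV (Pow UNIV) outer"
  interpret P: sigma_algebra UNIV "Pow UNIV :: 'k set set" by (rule sigma_algebra_Pow)
  have "outer_measure_space (Pow UNIV) outer"
    by (auto simp: outer_measure_space_def positive_def increasing_def countably_subadditive_def
        outer_open mass_empty outer_mono outer_UN)
  then have ms: "measure_space UNIV ?L outer" by (rule P.caratheodory_lemma)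
  then interpret L: sigma_algebra UNIV ?L by (simp add: measure_space_def)
  have "U \<in> ?L" if "open U" for U
    unfolding P.lambda_system_eq
  proof (clarsimp, rule antisym)
    fix E
    show "outer (E \<inter> U) + outer (E - U) \<le> outer E" using outer_split_open[OF that] .
    have "subadditive (Pow UNIV) outer"
      by (intro P.countably_subadditive_subadditive)
        (auto simp: positive_def countably_subadditive_def outer_open mass_empty outer_UN)
    then have "outer ((E \<inter> U) \<union> (E - U)) \<le> outer (E \<inter> U) + outer (E - U)"
      by (rule subadditiveD) auto
    then show "outer E \<le> outer (E \<inter> U) + outer (E - U)" by (simp add: Int_Diff_Un)
  qed
  then have "{U. open U} \<subseteq> ?L" by blast
  then have "sets borel \<subseteq> ?L"
    unfolding sets_borel by (rule L.sigma_sets_subset)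
  moreover have "sigma_algebra UNIV (sets (borel :: 'k measure))"
    using sets.sigma_algebra_axioms[of borel] by simp
  ultimately have "measure_space UNIV (sets borel) outer"
    using measure_down[OF ms] by blast
  then show ?thesis
    using assms unfolding radon_def measure_space_def by (intro emeasure_measure_of_sigma) auto
qed

lemma prob_space_radon: "prob_space radon"
  by (rule prob_spaceI) (simp add: space_radon emeasure_radon outer_open mass_UNIV)

text \<open>Outer regularity is built into \<open>outer\<close>. Inner regularity follows by
  approximating the complement from outside and taking complements again, since closed sets are
  compact here.\<close>

lemma regular_radon: "regular_probability_measure radon"
  unfolding regular_probability_measure_def
proof (intro conjI ballI prob_space_radon sets_radon)
  interpret prob_space radon by (rule prob_space_radon)
  fix A :: "'k set" assume A: "A \<in> sets borel"
  show "emeasure radon A = (INF U\<in>{U. open U \<and> A \<subseteq> U}. emeasure radon U)"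
    using A by (simp add: emeasure_radon outer_def[of A] outer_open)
  show "emeasure radon A = (SUP C\<in>{C. compact C \<and> C \<subseteq> A}. emeasure radon C)"
  proof (rule antisym)
    show "(SUP C\<in>{C. compact C \<and> C \<subseteq> A}. emeasure radon C) \<le> emeasure radon A"
      using A by (intro SUP_least emeasure_mono) (auto simp: sets_radon)
    show "emeasure radon A \<le> (SUP C\<in>{C. compact C \<and> C \<subseteq> A}. emeasure radon C)"
    proof (rule ennreal_le_epsilon)
      fix e :: real assume e: "0 < e"
      obtain U where U: "open U" "- A \<subseteq> U" "mass U \<le> outer (- A) + ennreal e"
        using outer_approx[OF e] by blast
      have "compact (- U)"
        using compact_UNIV U(1) by (metis Compl_eq_Diff_UNIV compact_diff)
      have m: "U \<in> events" "- A \<in> events" "A \<in> events"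
        using U(1) A by (auto simp: sets_radon)
      have "ennreal (prob U) \<le> ennreal (prob (-A) + e)"
        using U m e by (simp add: emeasure_radon outer_open sets_radon flip: emeasure_eq_measure)
      then have "prob U \<le> prob (-A) + e"
        using e by (subst (asm) ennreal_le_iff) (auto intro: add_nonneg_nonneg)
      moreover have "prob (-U) = 1 - prob U" "prob (-A) = 1 - prob A"
        using prob_compl[of U] prob_compl[of A] m by (auto simp: space_radon Compl_eq_Diff_UNIV)
      ultimately have "prob A \<le> prob (-U) + e" by simp
      then have "emeasure radon A \<le> emeasure radon (-U) + ennreal e"
        using e by (simp add: emeasure_eq_measure flip: ennreal_plus)
      also have "emeasure radon (-U) \<le> (SUP C\<in>{C. compact C \<and> C \<subseteq> A}. emeasure radon C)"
        using U \<open>compact (-U)\<close> by (intro SUP_upper) auto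
      finally show "emeasure radon A \<le> (SUP C\<in>{C. compact C \<and> C \<subseteq> A}. emeasure radon C) + ennreal e"
        by (simp add: add_right_mono)
    qed
  qed
qed

text \<open>Layer-cake estimate: \<open>f\<close> is cut into \<open>n\<close> slices of height \<open>1/n\<close>, and each slice is
  squeezed between multiples of indicators of superlevel sets of \<open>f\<close>.\<close>

lemma state_le_integral_radon_aux:
  assumes f: "f \<in> below UNIV" and n: "0 < (n::nat)"
  shows "\<phi> f \<le> (LINT x|radon. f x) + 1 / n"
proof -
  interpret prob_space radon by (rule prob_space_radon)
  have fc: "continuous_on UNIV f" "\<And>x. 0 \<le> f x" "\<And>x. f x \<le> 1"
    using f by (auto simp: below_def)
  define s where "s k x = min (1 / n) (max 0 (f x - k / n))" for k :: nat and x
  define p where "p k = prob {x. k / n < f x}" for k :: nat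
  have sc: "continuous_on UNIV (s k)" for k
    unfolding s_def using fc by (intro continuous_intros)
  have "(\<Sum>k<m. s k x) = min (f x) (m / n)" for m x
  proof (induction m)
    case 0
    then show ?case using fc(2)[of x] by simp
  next
    case (Suc m)
    have "min (f x) a + min b (max 0 (f x - a)) = min (f x) (a + b)" if "0 < b" for a b :: real
      using that by (simp add: min_def max_def)
    from this[of "1 / n" "m / n"] show ?case
      using n Suc by (simp add: s_def add_divide_distrib add.commute)
  qed
  then have slices: "f = (\<lambda>x. \<Sum>k<n. s k x)"
    using fc(3) n by (auto simp: min_absorb1)
  have op: "open {x. k / n < f x}" for k :: nat
    using fc by (intro open_Collect_less continuous_on_const)
  \<comment> \<open>\<open>n * s k\<close> takes values in the unit interval and vanishes unless
    \<open>k / n < f x\<close>, so it competes in the supremum that defines the mass of this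
    superlevel set.\<close>
  have upper: "\<phi> (s k) \<le> p k / n" for k
  proof -
    have "(\<lambda>x. n * s k x) \<in> below {x. k / n < f x}"
      using n sc[of k] by (auto simp: below_def s_def min_def field_simps intro!: continuous_intros)
    from below_le_mass[OF this] have "ennreal (n * \<phi> (s k)) \<le> ennreal (p k)"
      using op[of k] scale[OF sc]
      by (simp add: p_def emeasure_radon outer_open borel_open flip: emeasure_eq_measure)
    then show ?thesis using n by (simp add: p_def field_simps)
  qed
  have lower: "p (Suc k) / n \<le> (LINT x|radon. s k x)" for k
  proof -
    have "p (Suc k) / n = (LINT x|radon. indicator {x. Suc k / n < f x} x / n)"
      using op[of "Suc k"] by (simp add: p_def sets_radon space_radon)
    also have "\<dots> \<le> (LINT x|radon. s k x)"
    proof (rule integral_mono)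
      show "integrable radon (s k)"
        using continuous_integrable[OF compact_UNIV prob_space_radon sets_radon sc] .
      show "integrable radon (\<lambda>x. indicat_real {x. Suc k / n < f x} x / n)"
        using op[of "Suc k"] by (simp add: sets_radon less_top[symmetric])
      show "indicat_real {x. Suc k / n < f x} x / n \<le> s k x" for x
        using n by (auto simp: s_def indicator_def add_divide_distrib)
    qed
    finally show ?thesis .
  qed
  have "\<phi> f = (\<Sum>k<n. \<phi> (s k))"
    by (subst slices) (use sc in \<open>intro sum; simp\<close>)
  also have "\<dots> \<le> (\<Sum>k<n. p k / n)" by (intro sum_mono upper)
  \<comment> \<open>The two sums agree up to an index shift: they differ by
    \<open>(p 0 - p n) / n\<close>, and this is the source of the error
    \<open>1 / n\<close>.\<close>
  also have "\<dots> \<le> (\<Sum>k<n. p (Suc k) / n) + 1 / n"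
  proof -
    have "(\<Sum>k<Suc n. p k / n) = p 0 / n + (\<Sum>k<n. p (Suc k) / n)"
      by (rule sum.lessThan_Suc_shift)
    moreover have "p 0 / n \<le> 1 / n" "0 \<le> p n / n"
      using n by (auto simp: p_def divide_right_mono)
    ultimately show ?thesis by simp
  qed
  also have "(\<Sum>k<n. p (Suc k) / n) \<le> (\<Sum>k<n. LINT x|radon. s k x)" by (intro sum_mono lower)
  also have "\<dots> = (LINT x|radon. f x)"
    by (subst slices)
      (use continuous_integrable[OF compact_UNIV prob_space_radon sets_radon sc] in simp)
  finally show ?thesis by simp
qed

lemma state_le_integral_radon:
  assumes "f \<in> below UNIV"
  shows "\<phi> f \<le> (LINT x|radon. f x)"
proof (rule field_le_epsilon)
  fix e :: real assume "0 < e"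
  then obtain n where "1 / Suc n < e" by (rule nat_approx_posE)
  then show "\<phi> f \<le> (LINT x|radon. f x) + e"
    using state_le_integral_radon_aux[OF assms, of "Suc n"] by simp
qed

text \<open>Both sides are linear and send 1 to 1, so the inequality
  \<open>state_le_integral_radon\<close>, applied to \<open>g\<close> and to \<open>1 - g\<close>,
  becomes an equality. Here \<open>g\<close> is \<open>f\<close> rescaled affinely from the range
  \<open>-B\<close> to \<open>B\<close> to the unit interval.\<close>

lemma integral_radon:
  assumes f: "continuous_on UNIV f"
  shows "(LINT x|radon. f x) = \<phi> f"
proof -
  interpret prob_space radon by (rule prob_space_radon)
  obtain B where B: "0 < B" "\<And>x. \<bar>f x\<bar> \<le> B"
    using compact_continuous_bounded[OF compact_UNIV f] by blast
  have bd: "0 \<le> f x + B" "f x \<le> B" for x using B(2)[of x] by auto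
  define g where "g x = (1 / (2 * B)) * (f x + B)" for x
  have gc: "continuous_on UNIV g" unfolding g_def using f by (intro continuous_intros)
  have g: "g \<in> below UNIV" "(\<lambda>x. 1 - g x) \<in> below UNIV"
    using gc B(1) bd f by (auto simp: below_def g_def field_simps intro!: continuous_intros)
  have int: "integrable radon h" if "continuous_on UNIV h" for h :: "'k \<Rightarrow> real"
    using continuous_integrable[OF compact_UNIV prob_space_radon sets_radon that] .
  have "\<phi> (\<lambda>x. 1 - g x) = 1 - \<phi> g" using diff[of "\<lambda>x. 1" g] gc one by simp
  moreover have "(LINT x|radon. 1 - g x) = 1 - (LINT x|radon. g x)"
    using int[OF gc] prob_space by (simp add: space_radon)
  ultimately have eq: "\<phi> g = (LINT x|radon. g x)"
    using state_le_integral_radon[OF g(1)] state_le_integral_radon[OF g(2)] by simp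
  have "continuous_on UNIV (\<lambda>x. 2 * B * g x)" using gc by (intro continuous_intros)
  moreover have "f = (\<lambda>x. 2 * B * g x - B)" using B(1) by (auto simp: g_def field_simps)
  ultimately have "\<phi> f = 2 * B * \<phi> g - B" "(LINT x|radon. f x) = 2 * B * (LINT x|radon. g x) - B"
    using diff[of "\<lambda>x. 2 * B * g x" "\<lambda>x. B"] scale[OF gc] const[of B] gc int[OF gc]
    prob_space by (auto simp: space_radon)
  then show ?thesis using eq by simp
qed

end

section \<open>Extreme points and compactness of states\<close>

text \<open>The closed extremal subsets from the proof of the Krein-Milman theorem, for the product
  topology on \<open>'a \<Rightarrow> real\<close>, in which evaluation at each coordinate is
  continuous.\<close>

definition face :: "('a \<Rightarrow> real) set \<Rightarrow> ('a \<Rightarrow> real) set \<Rightarrow> bool" where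
  "face X G \<longleftrightarrow> closed G \<and> G \<subseteq> X \<and> G \<noteq> {} \<and>
     (\<forall>y\<in>X. \<forall>z\<in>X. \<forall>t. 0 < t \<longrightarrow> t < 1 \<longrightarrow> (\<lambda>j. t * y j + (1 - t) * z j) \<in> G \<longrightarrow> y \<in> G \<and> z \<in> G)"

lemma faceI:
  assumes "closed G" "G \<subseteq> X" "G \<noteq> {}"
    "\<And>y z t. y \<in> X \<Longrightarrow> z \<in> X \<Longrightarrow> 0 < t \<Longrightarrow> t < 1 \<Longrightarrow>
      (\<lambda>j. t * y j + (1 - t) * z j) \<in> G \<Longrightarrow> y \<in> G \<and> z \<in> G"
  shows "face X G"
  using assms by (simp add: face_def)

lemma faceD:
  assumes "face X G" "y \<in> X" "z \<in> X" "0 < t" "t < 1" "(\<lambda>j. t * y j + (1 - t) * z j) \<in> G"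
  shows "y \<in> G" "z \<in> G"
  using assms by (auto simp: face_def)

text \<open>A coordinate attains its minimum on a compact face, and a proper convex combination of
  two values that are at least the minimum can equal it only if both do.\<close>

lemma face_minimizers:
  assumes X: "compact X" and "face X G"
  shows "face X {y \<in> G. \<forall>z\<in>G. y j \<le> z j}"
proof -
  have clG: "closed G" and G: "compact G" "G \<noteq> {}"
    using compact_Int_closed[OF X, of G] assms(2) by (auto simp: face_def Int_absorb1)
  have "continuous_on G (\<lambda>y. y j)"
    by (rule continuous_on_subset[OF continuous_on_product_coordinates]) simp
  then obtain m where m: "m \<in> G" "\<forall>z\<in>G. m j \<le> z j"
    using continuous_attains_inf[OF G] by blast
  have eq: "{y \<in> G. \<forall>z\<in>G. y j \<le> z j} = G \<inter> {y. y j \<le> m j}"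
    using m by (auto intro: order_trans)
  have "closed {y :: 'a \<Rightarrow> real. y j \<le> m j}"
    by (intro closed_Collect_le continuous_on_const continuous_on_product_coordinates)
  then have "closed (G \<inter> {y. y j \<le> m j})" using clG by (intro closed_Int)
  moreover have "y \<in> G \<inter> {y. y j \<le> m j} \<and> z \<in> G \<inter> {y. y j \<le> m j}"
    if "y \<in> X" "z \<in> X" "0 < t" "t < 1" "(\<lambda>j. t * y j + (1 - t) * z j) \<in> G \<inter> {y. y j \<le> m j}"
    for y z t
  proof -
    have yz: "y \<in> G" "z \<in> G" using that assms by (auto simp: face_def)
    have "t * y j + (1 - t) * z j \<le> m j" using that by simp
    moreover have "m j \<le> y j" "m j \<le> z j" using yz m by auto
    then have "t * m j \<le> t * y j" "(1 - t) * m j \<le> (1 - t) * z j"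
      using that by (auto intro!: mult_left_mono)
    ultimately have "t * y j \<le> t * m j" "(1 - t) * z j \<le> (1 - t) * m j"
      by (auto simp: algebra_simps)
    then show ?thesis using yz that by simp
  qed
  ultimately show ?thesis
    unfolding eq using assms m by (auto simp: face_def)
qed

definition extreme_in :: "('a \<Rightarrow> real) set \<Rightarrow> ('a \<Rightarrow> real) \<Rightarrow> bool" where
  "extreme_in X e \<longleftrightarrow> e \<in> X \<and> (\<forall>y\<in>X. \<forall>z\<in>X. \<forall>t. 0 < t \<longrightarrow> t < 1 \<longrightarrow>
     e = (\<lambda>j. t * y j + (1 - t) * z j) \<longrightarrow> y = e \<and> z = e)"

text \<open>The Krein-Milman argument started inside the face of minimizers of coordinate
  \<open>i\<close>. On a minimal face every coordinate is constant, because its minimizers form a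
  smaller face otherwise; so a minimal face is a single point, which is extreme and still minimizes
  coordinate \<open>i\<close>.\<close>

lemma extreme_minimizer_exists:
  fixes X :: "('a \<Rightarrow> real) set"
  assumes "compact X" "closed X" "X \<noteq> {}"
  obtains e where "extreme_in X e" "\<And>y. y \<in> X \<Longrightarrow> e i \<le> y i"
proof -
  define G0 where "G0 = {y \<in> X. \<forall>z\<in>X. y i \<le> z i}"
  have "face X X" using assms by (auto simp: face_def)
  then have G0: "face X G0" unfolding G0_def by (rule face_minimizers[OF assms(1)])
  \<comment> \<open>Zorn's lemma produces maximal elements here, so a minimal face is sought as a
    maximal complement.\<close>
  define \<A> where "\<A> = uminus ` {G. face X G \<and> G \<subseteq> G0}"
  have "\<exists>M\<in>\<A>. \<forall>Y\<in>\<A>. M \<subseteq> Y \<longrightarrow> Y = M"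
  proof (rule subset_Zorn_nonempty)
    show "\<A> \<noteq> {}" using G0 by (auto simp: \<A>_def)
    fix \<C> assume C: "\<C> \<noteq> {}" "subset.chain \<A> \<C>"
    define \<D> where "\<D> = uminus ` \<C>"
    have D: "face X G" "G \<subseteq> G0" if "G \<in> \<D>" for G
      using that C(2) by (auto simp: \<D>_def \<A>_def subset_chain_def)
    have "\<Inter>\<D> \<noteq> {}"
    proof -
      have chain: "subset.chain \<D> \<D>"
        using C(2) unfolding \<D>_def subset_chain_def by auto
      \<comment> \<open>A finite nonempty part of a chain contains its own intersection, which is
        therefore a face and meets \<open>X\<close>. Compactness of \<open>X\<close> passes from
        finite parts to the whole chain.\<close>
      have "X \<inter> \<Inter>B \<noteq> {}" if "B \<subseteq> \<D>" "finite B" for B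
      proof (cases "B = {}")
        case False
        have "\<Inter>B \<in> B"
          using that False chain by (intro Inter_in_chain[of B \<D>]) (auto simp: subset_chain_def)
        then have "face X (\<Inter>B)" using that D by blast
        then have "\<Inter>B \<noteq> {}" "\<Inter>B \<subseteq> X" by (auto simp: face_def simp del: Inf_eq_bot_iff)
        then show ?thesis by (simp add: Int_absorb1)
      qed (use assms in simp)
      moreover have "closed G" if "G \<in> \<D>" for G
        using D[OF that] by (auto simp: face_def)
      moreover have "(\<forall>G\<in>\<D>. closed G) \<longrightarrow> (\<forall>B\<subseteq>\<D>. finite B \<longrightarrow> X \<inter> \<Inter>B \<noteq> {}) \<longrightarrow> X \<inter> \<Inter>\<D> \<noteq> {}"
        using assms(1) unfolding compact_fip by (rule spec)
      ultimately have "X \<inter> \<Inter>\<D> \<noteq> {}" by simp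
      then show ?thesis by blast
    qed
    have sub: "\<Inter>\<D> \<subseteq> G0" using C(1) D(2) by (auto simp: \<D>_def)
    have "face X (\<Inter>\<D>)"
    proof (rule faceI)
      show "closed (\<Inter>\<D>)" using D by (intro closed_Inter) (auto simp: face_def)
      show "\<Inter>\<D> \<subseteq> X" using sub by (auto simp: G0_def)
      show "\<Inter>\<D> \<noteq> {}" by fact
      fix y z t assume *: "y \<in> X" "z \<in> X" "0 < t" "t < 1" "(\<lambda>j. t * y j + (1 - t) * z j) \<in> \<Inter>\<D>"
      have "y \<in> G \<and> z \<in> G" if G: "G \<in> \<D>" for G
        using faceD[OF D(1)[OF G] *(1-4)] *(5) G by simp
      then show "y \<in> \<Inter>\<D> \<and> z \<in> \<Inter>\<D>" by simp
    qed
    moreover have "\<Union>\<C> = - \<Inter>\<D>" by (auto simp: \<D>_def)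
    ultimately show "\<Union>\<C> \<in> \<A>" using sub by (auto simp: \<A>_def)
  qed
  then obtain M where M: "M \<in> \<A>" "\<forall>Y\<in>\<A>. M \<subseteq> Y \<longrightarrow> Y = M" by blast
  obtain G where G: "face X G" "G \<subseteq> G0"
    and min: "\<And>G'. face X G' \<Longrightarrow> G' \<subseteq> G \<Longrightarrow> G' = G"
  proof -
    obtain G where G: "face X G" "G \<subseteq> G0" "M = - G" using M(1) by (auto simp: \<A>_def)
    show thesis
    proof (rule that[OF G(1,2)])
      fix G' assume "face X G'" "G' \<subseteq> G"
      then have "- G' \<in> \<A>" using G(2) by (auto simp: \<A>_def)
      then show "G' = G" using M(2) \<open>G' \<subseteq> G\<close> G(3) by (metis Compl_subset_Compl_iff compl_eq_compl_iff)
    qed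
  qed
  have const: "y j = z j" if "y \<in> G" "z \<in> G" for y z j
  proof -
    have "{y \<in> G. \<forall>z\<in>G. y j \<le> z j} = G"
      using min[OF face_minimizers[OF assms(1) G(1)], of j] by auto
    then show ?thesis using that by (metis (mono_tags, lifting) mem_Collect_eq order_antisym)
  qed
  obtain e where e: "e \<in> G" using G by (auto simp: face_def)
  have single: "y = e" if "y \<in> G" for y using const[OF that e] by auto
  show thesis
  proof (rule that)
    have eX: "e \<in> X" and le: "\<And>y. y \<in> X \<Longrightarrow> e i \<le> y i" using e G(2) by (auto simp: G0_def)
    show "e i \<le> y i" if "y \<in> X" for y using le that .
    have "y = e \<and> z = e" if "y \<in> X" "z \<in> X" "0 < t" "t < 1" "e = (\<lambda>j. t * y j + (1 - t) * z j)"
      for y z t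
    proof -
      have "(\<lambda>j. t * y j + (1 - t) * z j) \<in> G" using e that(5) by (rule back_subst)
      from faceD[OF G(1) that(1-4) this] show ?thesis using single by blast
    qed
    then show "extreme_in X e" using eX unfolding extreme_in_def by (intro conjI ballI allI impI) blast+
  qed
qed

section \<open>Weak-* compactness of the invariant states\<close>

lemma compact_box_fun: "compact {f :: 'a \<Rightarrow> real. \<forall>i. \<bar>f i\<bar> \<le> B i}"
proof -
  have "compactin (product_topology (\<lambda>i. euclidean) UNIV) (PiE UNIV (\<lambda>i. {- B i..B i}))"
    by (simp add: compactin_PiE)
  moreover have "PiE UNIV (\<lambda>i. {- B i..B i}) = {f :: 'a \<Rightarrow> real. \<forall>i. \<bar>f i\<bar> \<le> B i}"
  proof -
    have "r \<in> {- b..b} \<longleftrightarrow> \<bar>r\<bar> \<le> b" for r b :: real by auto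
    then show ?thesis by (simp add: PiE_UNIV_domain Pi_def)
  qed
  ultimately show ?thesis by (simp add: euclidean_product_topology)
qed

text \<open>The set \<open>\<Sigma>\<close> is arbitrary so that \<open>invariant_states {}\<close>
  can serve as the set of all states, in which cluster points of orbit averages are found before
  their invariance is known.\<close>

definition invariant_states :: "('k \<Rightarrow> 'k) set \<Rightarrow> (('k::topological_space \<Rightarrow> real) \<Rightarrow> real) set" where
  "invariant_states \<Sigma> =
     {\<phi>. state \<phi> \<and> (\<forall>\<sigma>\<in>\<Sigma>. \<forall>f. continuous_on UNIV f \<longrightarrow> \<phi> (\<lambda>x. f (\<sigma> x)) = \<phi> f)}"

text \<open>Every clause is an equation or weak inequality between finitely many evaluations of
  \<open>\<phi>\<close>, guarded by a premise that does not mention \<open>\<phi>\<close>.\<close>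

lemma closed_invariant_states: "closed (invariant_states \<Sigma>)"
proof -
  have imp: "closed {\<phi>. P \<longrightarrow> Q \<phi>}" if "closed {\<phi>. Q \<phi>}"
    for P and Q :: "(('k::topological_space \<Rightarrow> real) \<Rightarrow> real) \<Rightarrow> bool"
    using that by (cases P) auto
  show ?thesis
    unfolding invariant_states_def state_def Ball_def
    by (intro closed_Collect_conj closed_Collect_all imp closed_Collect_eq closed_Collect_le
        continuous_intros continuous_on_product_coordinates)
qed

text \<open>Any bound of a continuous function does the work of its supremum norm. The value 0
  elsewhere matches the last clause of \<open>state\<close>, so that all states lie in a single
  box.\<close>

definition sup_bound :: "('k::topological_space \<Rightarrow> real) \<Rightarrow> real" where
  "sup_bound f = (if continuous_on UNIV f then SOME B. \<forall>x. \<bar>f x\<bar> \<le> B else 0)"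

lemma abs_le_sup_bound:
  fixes f :: "'k::topological_space \<Rightarrow> real"
  assumes "compact (UNIV :: 'k set)" "continuous_on UNIV f"
  shows "\<bar>f x\<bar> \<le> sup_bound f"
proof -
  obtain B where "\<forall>x. \<bar>f x\<bar> \<le> B" using compact_continuous_bounded[OF assms] by metis
  then have "\<forall>x. \<bar>f x\<bar> \<le> (SOME B. \<forall>x. \<bar>f x\<bar> \<le> B)" by (rule someI)
  then show ?thesis using assms(2) by (simp add: sup_bound_def)
qed

lemma state_abs_le:
  fixes \<phi> :: "('k::t2_space \<Rightarrow> real) \<Rightarrow> real"
  assumes "compact (UNIV :: 'k set)" "state \<phi>"
  shows "\<bar>\<phi> f\<bar> \<le> sup_bound f"
proof -
  interpret state_on_compact \<phi> using assms by unfold_locales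
  show ?thesis
  proof (cases "continuous_on UNIV f")
    case True
    have "f x \<le> sup_bound f" "- sup_bound f \<le> f x" for x
      using abs_le_sup_bound[OF assms(1) True, of x] by auto
    then show ?thesis
      using mono[OF True continuous_on_const, of "sup_bound f"]
        mono[OF continuous_on_const True, of "- sup_bound f"] const by auto
  next
    case False
    then show ?thesis using assms(2) by (simp add: state_def sup_bound_def)
  qed
qed

text \<open>The Banach-Alaoglu theorem for states: a closed subset of a product of compact
  intervals.\<close>

lemma compact_invariant_states:
  assumes "compact (UNIV :: 'k::t2_space set)"
  shows "compact (invariant_states (\<Sigma> :: ('k \<Rightarrow> 'k) set))"
proof -
  have "invariant_states \<Sigma> \<subseteq> {\<phi>. \<forall>f. \<bar>\<phi> f\<bar> \<le> sup_bound f}"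
    using state_abs_le[OF assms] by (auto simp: invariant_states_def)
  then show ?thesis
    using compact_Int_closed[OF compact_box_fun closed_invariant_states, of sup_bound \<Sigma>]
    by (simp add: inf_absorb2)
qed

section \<open>Regular measures\<close>

lemma regular_prob_space: "regular_probability_measure \<mu> \<Longrightarrow> prob_space \<mu>"
  and regular_sets: "regular_probability_measure \<mu> \<Longrightarrow> sets \<mu> = sets borel"
  by (auto simp: regular_probability_measure_def)

lemma regular_space: "regular_probability_measure \<mu> \<Longrightarrow> space \<mu> = UNIV"
  using sets_eq_imp_space_eq[OF regular_sets] by auto

lemma regular_outer:
  assumes "regular_probability_measure \<mu>" "A \<in> sets borel" "0 < e"
  obtains U where "open U" "A \<subseteq> U" "measure \<mu> U < measure \<mu> A + e"
proof -
  interpret prob_space \<mu> using assms(1) by (rule regular_prob_space)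
  have "emeasure \<mu> A < emeasure \<mu> A + ennreal e"
    using assms(3) by (simp add: emeasure_eq_measure ennreal_less_iff flip: ennreal_plus)
  moreover have "emeasure \<mu> A = (INF U\<in>{U. open U \<and> A \<subseteq> U}. emeasure \<mu> U)"
    using assms(1,2) unfolding regular_probability_measure_def by blast
  ultimately obtain U where "open U" "A \<subseteq> U" "emeasure \<mu> U < emeasure \<mu> A + ennreal e"
    by (metis (mono_tags, lifting) INF_less_iff mem_Collect_eq)
  then show thesis
    using assms(3) by (intro that[of U]) (auto simp: emeasure_eq_measure ennreal_less_iff simp flip: ennreal_plus)
qed

lemma regular_inner:
  assumes "regular_probability_measure \<mu>" "A \<in> sets borel" "0 < e"
  obtains C where "compact C" "C \<subseteq> A" "measure \<mu> A - e < measure \<mu> C"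
proof (cases "measure \<mu> A < e")
  \<comment> \<open>Small sets are treated apart so that \<open>measure \<mu> A - e\<close> is
    nonnegative below and its image under \<open>ennreal\<close> is not cut off at 0.\<close>
  case True
  then show thesis by (intro that[of "{}"]) auto
next
  case False
  interpret prob_space \<mu> using assms(1) by (rule regular_prob_space)
  have "ennreal (measure \<mu> A - e) < emeasure \<mu> A"
    using assms(3) False by (simp add: emeasure_eq_measure ennreal_less_iff)
  moreover have "emeasure \<mu> A = (SUP C\<in>{C. compact C \<and> C \<subseteq> A}. emeasure \<mu> C)"
    using assms(1,2) unfolding regular_probability_measure_def by blast
  ultimately obtain C where "compact C" "C \<subseteq> A" "ennreal (measure \<mu> A - e) < emeasure \<mu> C"
    by (metis (mono_tags, lifting) less_SUP_iff mem_Collect_eq)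
  then show thesis
    using False by (intro that[of C]) (auto simp: emeasure_eq_measure ennreal_less_iff)
qed

lemma regular_Urysohn:
  fixes \<mu> :: "'k::t2_space measure"
  assumes K: "compact (UNIV :: 'k set)" and \<mu>: "regular_probability_measure \<mu>"
    and C: "closed C" and U: "open U" "C \<subseteq> U"
  obtains h :: "'k \<Rightarrow> real" where "continuous_on UNIV h" "\<And>x. indicator C x \<le> h x"
    "\<And>x. h x \<le> indicator U x" "measure \<mu> C \<le> (LINT x|\<mu>. h x)" "(LINT x|\<mu>. h x) \<le> measure \<mu> U"
proof -
  interpret prob_space \<mu> using \<mu> by (rule regular_prob_space)
  note sets = regular_sets[OF \<mu>] and space = regular_space[OF \<mu>]
  obtain h :: "'k \<Rightarrow> real" where h: "continuous_on UNIV h" "\<And>x. 0 \<le> h x" "\<And>x. h x \<le> 1"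
    "\<And>x. x \<in> -U \<Longrightarrow> h x = 0" "\<And>x. x \<in> C \<Longrightarrow> h x = 1"
    using compact_t2_Urysohn[OF K, of "-U" C] C U by auto
  have hi: "integrable \<mu> h" using continuous_integrable[OF K prob_space_axioms sets h(1)] .
  have le: "indicator C x \<le> h x" "h x \<le> indicator U x" for x
    using h by (auto simp: indicator_def)
  have ind: "integrable \<mu> (indicator C :: 'k \<Rightarrow> real)" "integrable \<mu> (indicator U :: 'k \<Rightarrow> real)"
    using C U by (auto simp: sets less_top[symmetric])
  have "(LINT x|\<mu>. indicator C x) \<le> (LINT x|\<mu>. h x)" "(LINT x|\<mu>. h x) \<le> (LINT x|\<mu>. indicator U x)"
    by (rule integral_mono[OF ind(1) hi le(1)], rule integral_mono[OF hi ind(2) le(2)])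
  then show thesis using that[OF h(1) le] by (simp add: space)
qed

text \<open>For an indicator, regularity traps the set between a compact and an open set of nearly
  equal measure, and a Urysohn function between the two is close to it. Sums and dominated limits
  extend this to all integrable functions.\<close>

lemma continuous_L1_dense:
  fixes f :: "'k::t2_space \<Rightarrow> 'b::{banach, second_countable_topology}"
  assumes K: "compact (UNIV :: 'k set)" and \<mu>: "regular_probability_measure \<mu>"
    and f: "integrable \<mu> f" and e: "0 < e"
  obtains h where "continuous_on UNIV h" "(LINT x|\<mu>. norm (h x - f x)) < e"
proof -
  interpret prob_space \<mu> using \<mu> by (rule regular_prob_space)
  note sets = regular_sets[OF \<mu>] and space = regular_space[OF \<mu>]
  have int: "integrable \<mu> h" if "continuous_on UNIV h" for h :: "'k \<Rightarrow> 'b"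
    using continuous_integrable[OF K prob_space_axioms sets that] .
  have int': "integrable \<mu> h" if "continuous_on UNIV h" for h :: "'k \<Rightarrow> real"
    using continuous_integrable[OF K prob_space_axioms sets that] .
  from f have "\<forall>e>0. \<exists>h. continuous_on UNIV h \<and> (LINT x|\<mu>. norm (h x - f x)) < e"
  proof (induction rule: integrable_induct)
    case (base A c)
    show ?case
    proof (intro allI impI)
      fix e :: real assume "0 < e"
      \<comment> \<open>The indicators of \<open>C\<close> and \<open>U\<close> will differ by less
        than \<open>2 * d\<close> in mean, and \<open>c\<close> multiplies this error by
        \<open>norm c\<close>; the summand 1 keeps the denominator positive when \<open>c\<close> is
        0.\<close>
      define d where "d = e / (2 * (norm c + 1))"
      have d: "0 < d" using \<open>0 < e\<close> by (simp add: d_def add_nonneg_pos)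
      have A: "A \<in> sets borel" using base sets by simp
      obtain U where U: "open U" "A \<subseteq> U" "measure \<mu> U < measure \<mu> A + d"
        using regular_outer[OF \<mu> A d] by blast
      obtain C where C: "compact C" "C \<subseteq> A" "measure \<mu> A - d < measure \<mu> C"
        using regular_inner[OF \<mu> A d] by blast
      have clC: "closed C" using C(1) by (rule compact_imp_closed)
      have "C \<subseteq> U" using C U by blast
      obtain h :: "'k \<Rightarrow> real" where h: "continuous_on UNIV h" "\<And>x. indicator C x \<le> h x"
        "\<And>x. h x \<le> indicator U x"
        using regular_Urysohn[OF K \<mu> clC U(1) \<open>C \<subseteq> U\<close>] by metis
      have m: "U \<in> events" "C \<in> events" using U clC by (auto simp: sets)
      have ind: "integrable \<mu> (indicator C :: 'k \<Rightarrow> real)" "integrable \<mu> (indicator U :: 'k \<Rightarrow> real)"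
        "integrable \<mu> (indicator A :: 'k \<Rightarrow> real)"
        using m base by (auto simp: less_top[symmetric])
      have "\<bar>h x - indicator A x\<bar> \<le> indicator U x - indicator C x" for x
        using h(2)[of x] h(3)[of x] U(2) C(2) by (auto simp: indicator_def split: if_splits)
      then have "(LINT x|\<mu>. \<bar>h x - indicator A x\<bar>) \<le> (LINT x|\<mu>. indicator U x - indicator C x)"
        using int'[OF h(1)] ind by (intro integral_mono) auto
      also have "\<dots> = measure \<mu> U - measure \<mu> C" using ind by (simp add: space)
      also have "\<dots> < 2 * d" using U C by simp
      finally have hA: "(LINT x|\<mu>. \<bar>h x - indicator A x\<bar>) < 2 * d" .
      have "norm (h x *\<^sub>R c - indicator A x *\<^sub>R c) = \<bar>h x - indicator A x\<bar> * norm c" for x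
        by (simp flip: scaleR_left_diff_distrib)
      then have "(LINT x|\<mu>. norm (h x *\<^sub>R c - indicator A x *\<^sub>R c)) =
          (LINT x|\<mu>. \<bar>h x - indicator A x\<bar>) * norm c" by simp
      also have "\<dots> \<le> 2 * d * norm c" using hA by (intro mult_right_mono) auto
      also have "\<dots> < 2 * d * (norm c + 1)" using d by simp
      also have "\<dots> = e"
      proof -
        have "2 * (norm c + 1) \<noteq> 0" using norm_ge_zero[of c] by (simp add: add_nonneg_eq_0_iff)
        then have "e = d * (2 * (norm c + 1))"
          using nonzero_divide_eq_eq[of "2 * (norm c + 1)" e d] d_def by blast
        then show ?thesis by (simp add: algebra_simps)
      qed
      finally show "\<exists>h. continuous_on UNIV h \<and> (LINT x|\<mu>. norm (h x - indicator A x *\<^sub>R c)) < e"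
        using h(1) by (intro exI[of _ "\<lambda>x. h x *\<^sub>R c"]) (auto intro!: continuous_intros)
    qed
  next
    case (add f g)
    show ?case
    proof (intro allI impI)
      fix e :: real assume "0 < e"
      then have "0 < e / 2" by simp
      then obtain h k where h: "continuous_on UNIV h" "(LINT x|\<mu>. norm (h x - f x)) < e / 2"
        and k: "continuous_on UNIV k" "(LINT x|\<mu>. norm (k x - g x)) < e / 2"
        using add by meson
      have "(LINT x|\<mu>. norm (h x + k x - (f x + g x))) \<le>
          (LINT x|\<mu>. norm (h x - f x) + norm (k x - g x))"
        using int[OF h(1)] int[OF k(1)] add.hyps by (intro integral_mono) (auto simp: norm_diff_triangle_ineq)
      also have "\<dots> = (LINT x|\<mu>. norm (h x - f x)) + (LINT x|\<mu>. norm (k x - g x))"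
        using int[OF h(1)] int[OF k(1)] add.hyps by simp
      finally show "\<exists>h. continuous_on UNIV h \<and> (LINT x|\<mu>. norm (h x - (f x + g x))) < e"
        using h k by (intro exI[of _ "\<lambda>x. h x + k x"]) (auto intro!: continuous_intros)
    qed
  next
    case (lim f s)
    show ?case
    proof (intro allI impI)
      fix e :: real assume "0 < e"
      have [measurable]: "f \<in> borel_measurable \<mu>" "\<And>i. s i \<in> borel_measurable \<mu>"
        using lim by auto
      \<comment> \<open>The induction rule provides
        \<open>norm (s i x) \<le> 2 * norm (f x)\<close>, hence the factor 3 in the
        majorant.\<close>
      have "(\<lambda>i. LINT x|\<mu>. norm (s i x - f x)) \<longlonglongrightarrow> (LINT x|\<mu>. 0 :: real)"
      proof (rule integral_dominated_convergence[where w="\<lambda>x. 3 * norm (f x)"])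
        show "integrable \<mu> (\<lambda>x. 3 * norm (f x))" using lim by simp
        show "AE x in \<mu>. (\<lambda>i. norm (s i x - f x)) \<longlonglongrightarrow> 0"
          using lim.hyps(2) by (intro AE_I2) (simp add: tendsto_norm_zero LIM_zero)
        have "norm (s i x - f x) \<le> 3 * norm (f x)" if "x \<in> space \<mu>" for i x
          using lim.hyps(3)[OF that, of i] norm_triangle_ineq4[of "s i x" "f x"] by simp
        then show "AE x in \<mu>. norm (norm (s i x - f x)) \<le> 3 * norm (f x)" for i
          by (intro AE_I2) simp
      qed auto
      then have "eventually (\<lambda>i. (LINT x|\<mu>. norm (s i x - f x)) < e / 2) sequentially"
        using \<open>0 < e\<close> by (intro order_tendstoD) auto
      then obtain i where i: "(LINT x|\<mu>. norm (s i x - f x)) < e / 2"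
        by (auto simp: eventually_sequentially)
      obtain h where h: "continuous_on UNIV h" "(LINT x|\<mu>. norm (h x - s i x)) < e / 2"
        using lim.IH[of i] \<open>0 < e\<close> by (meson half_gt_zero)
      have "(LINT x|\<mu>. norm (h x - f x)) \<le> (LINT x|\<mu>. norm (h x - s i x) + norm (s i x - f x))"
        using int[OF h(1)] lim by (intro integral_mono) (auto intro: norm_triangle_sub order_trans[OF _ norm_triangle_ineq])
      also have "\<dots> = (LINT x|\<mu>. norm (h x - s i x)) + (LINT x|\<mu>. norm (s i x - f x))"
        using int[OF h(1)] lim by simp
      finally show "\<exists>h. continuous_on UNIV h \<and> (LINT x|\<mu>. norm (h x - f x)) < e"
        using h i by auto
    qed
  qed
  then show thesis using that e by blast
qed

text \<open>This carries invariance from continuous functions to Borel sets. Preimages of compact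
  sets do not gain measure, by Urysohn functions and outer regularity. For Borel \<open>A\<close>, a
  compact \<open>C\<close> that nearly exhausts the preimage has a compact image inside
  \<open>A\<close>, so the same inequality holds for \<open>A\<close>; complements give the reverse
  one. Regularity of the image measure is a consequence and is nowhere presupposed.\<close>

lemma distr_eq_of_invariant:
  fixes \<mu> :: "'k::t2_space measure"
  assumes K: "compact (UNIV :: 'k set)" and \<mu>: "regular_probability_measure \<mu>"
    and \<sigma>: "continuous_on UNIV \<sigma>"
    and inv: "\<And>g :: 'k \<Rightarrow> real. continuous_on UNIV g \<Longrightarrow> (LINT x|\<mu>. g (\<sigma> x)) = (LINT x|\<mu>. g x)"
  shows "distr \<mu> borel \<sigma> = \<mu>"
proof -
  interpret prob_space \<mu> using \<mu> by (rule regular_prob_space)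
  note sets = regular_sets[OF \<mu>] and space = regular_space[OF \<mu>]
  have mb[measurable]: "\<sigma> \<in> measurable \<mu> borel"
    using borel_measurable_continuous_onI[OF \<sigma>] by (simp cong: measurable_cong_sets add: sets)
  have vm: "\<sigma> -` A \<in> events" if "A \<in> sets borel" for A
    using measurable_sets[OF mb that] by (simp add: space)
  have compact_le: "prob (\<sigma> -` D) \<le> prob D" if "compact D" for D
  proof (rule field_le_epsilon)
    fix e :: real assume e: "0 < e"
    have D: "closed D" "D \<in> sets borel" using compact_imp_closed[OF that] by auto
    obtain U where U: "open U" "D \<subseteq> U" "prob U < prob D + e"
      using regular_outer[OF \<mu> D(2) e] by blast
    obtain h :: "'k \<Rightarrow> real" where h: "continuous_on UNIV h" "\<And>x. indicator D x \<le> h x"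
      "\<And>x. h x \<le> indicator U x" "(LINT x|\<mu>. h x) \<le> prob U"
      using regular_Urysohn[OF K \<mu> D(1) U(1,2)] by metis
    have c: "continuous_on UNIV (\<lambda>x. h (\<sigma> x))"
      using continuous_on_compose2[OF h(1) \<sigma>] by simp
    have "prob (\<sigma> -` D) = (LINT x|\<mu>. indicator (\<sigma> -` D) x)" by (simp add: space)
    also have "\<dots> \<le> (LINT x|\<mu>. h (\<sigma> x))"
    proof (rule integral_mono)
      show "integrable \<mu> (indicat_real (\<sigma> -` D))"
        using vm[OF D(2)] by (simp add: less_top[symmetric])
      show "integrable \<mu> (\<lambda>x. h (\<sigma> x))"
        using continuous_integrable[OF K prob_space_axioms sets c] .
      show "indicat_real (\<sigma> -` D) x \<le> h (\<sigma> x)" for x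
        using h(2)[of "\<sigma> x"] by (simp add: indicator_def)
    qed
    also have "\<dots> = (LINT x|\<mu>. h x)" using inv[OF h(1)] .
    finally show "prob (\<sigma> -` D) \<le> prob D + e" using h U by simp
  qed
  have le: "prob (\<sigma> -` A) \<le> prob A" if A: "A \<in> sets borel" for A
  proof (rule field_le_epsilon)
    fix e :: real assume e: "0 < e"
    have "\<sigma> -` A \<in> sets borel" using vm[OF A] sets by simp
    then obtain C where C: "compact C" "C \<subseteq> \<sigma> -` A" "prob (\<sigma> -` A) - e < prob C"
      using regular_inner[OF \<mu> _ e] by blast
    have cD: "compact (\<sigma> ` C)"
      using C(1) \<sigma> by (intro compact_continuous_image continuous_on_subset[OF \<sigma>]) auto
    then have D: "\<sigma> ` C \<in> sets borel" using compact_imp_closed[OF cD] by auto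
    have "prob C \<le> prob (\<sigma> -` (\<sigma> ` C))"
      using vm[OF D] by (intro finite_measure_mono) auto
    also have "\<dots> \<le> prob (\<sigma> ` C)" using compact_le[OF cD] .
    also have "\<dots> \<le> prob A" using C A by (intro finite_measure_mono) (auto simp: sets)
    finally show "prob (\<sigma> -` A) \<le> prob A + e" using C by simp
  qed
  show ?thesis
  proof (rule measure_eqI)
    show "sets (distr \<mu> borel \<sigma>) = events" by (simp add: sets)
    fix A assume "A \<in> sets (distr \<mu> borel \<sigma>)"
    then have A: "A \<in> sets borel" by simp
    have "1 - prob (\<sigma> -` A) \<le> 1 - prob A"
      using le[of "- A"] prob_compl[OF vm[OF A]] prob_compl[of A] A
      by (simp add: space sets vimage_Compl Compl_eq_Diff_UNIV[symmetric])
    then show "emeasure (distr \<mu> borel \<sigma>) A = emeasure \<mu> A"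
      using le[OF A] A by (simp add: emeasure_distr space emeasure_eq_measure)
  qed
qed

section \<open>Extreme invariant states are ergodic\<close>

lemma apply_bcontfun_Bcontfun:
  fixes f :: "'k::topological_space \<Rightarrow> complex"
  assumes "compact (UNIV :: 'k set)" "continuous_on UNIV f"
  shows "apply_bcontfun (Bcontfun f) = f"
proof -
  have "bounded (range f)"
    using assms by (intro compact_imp_bounded compact_continuous_image)
  then show ?thesis using assms by (intro Bcontfun_inverse) (simp add: bcontfun_def)
qed

lemma koopman_apply:
  fixes act :: "'g \<Rightarrow> 'k::topological_space \<Rightarrow> 'k"
  assumes "compact (UNIV :: 'k set)" "continuous_on UNIV (act s)"
  shows "apply_bcontfun (koopman act s f) x = apply_bcontfun f (act s x)"
proof -
  have "continuous_on UNIV (\<lambda>x. apply_bcontfun f (act s x))"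
    by (rule continuous_on_compose2[OF _ assms(2), of UNIV]) auto
  then show ?thesis unfolding koopman_def by (simp add: apply_bcontfun_Bcontfun[OF assms(1)])
qed

text \<open>Passage from complex test functions, as in the definition, to the real ones on which
  states are evaluated: real and imaginary parts in one direction, the embedding of the reals in the
  other.\<close>

lemma invariant_measures_koopman_iff:
  fixes act :: "'g \<Rightarrow> 'k::topological_space \<Rightarrow> 'k"
  assumes K: "compact (UNIV :: 'k set)" and c: "\<And>s. s \<in> H \<Longrightarrow> continuous_on UNIV (act s)"
  shows "\<mu> \<in> invariant_measures (koopman_semigroup H act) \<longleftrightarrow>
    regular_probability_measure \<mu> \<and>
    (\<forall>s\<in>H. \<forall>g :: 'k \<Rightarrow> real. continuous_on UNIV g \<longrightarrow> (LINT x|\<mu>. g (act s x)) = (LINT x|\<mu>. g x))"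
    (is "?L \<longleftrightarrow> _ \<and> ?R")
proof -
  have "?R" if L: ?L
  proof (intro ballI allI impI)
    fix s and g :: "'k \<Rightarrow> real" assume s: "s \<in> H" and g: "continuous_on UNIV g"
    let ?f = "Bcontfun (\<lambda>x. complex_of_real (g x))"
    have f: "apply_bcontfun ?f = (\<lambda>x. complex_of_real (g x))"
      using g by (intro apply_bcontfun_Bcontfun[OF K] continuous_intros)
    have "(LINT x|\<mu>. apply_bcontfun (koopman act s ?f) x) = (LINT x|\<mu>. apply_bcontfun ?f x)"
      using L s by (auto simp: invariant_measures_def koopman_semigroup_def)
    then show "(LINT x|\<mu>. g (act s x)) = (LINT x|\<mu>. g x)"
      by (simp add: koopman_apply[where act = act and s = s, OF K c[OF s]] f)
  qed
  moreover have ?L if \<mu>: "regular_probability_measure \<mu>" and R: ?R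
    unfolding invariant_measures_def koopman_semigroup_def
  proof (clarsimp, intro conjI \<mu> ballI allI)
    fix s and f :: "'k \<Rightarrow>\<^sub>C complex" assume s: "s \<in> H"
    have c1: "continuous_on UNIV (\<lambda>x. apply_bcontfun f (act s x))"
      by (rule continuous_on_compose2[OF _ c[OF s], of UNIV]) auto
    have i: "integrable \<mu> (apply_bcontfun f)" "integrable \<mu> (\<lambda>x. apply_bcontfun f (act s x))"
      using continuous_integrable[OF K regular_prob_space[OF \<mu>] regular_sets[OF \<mu>]] c1 by auto
    have "(LINT x|\<mu>. Re (f (act s x))) = (LINT x|\<mu>. Re (f x))"
      "(LINT x|\<mu>. Im (f (act s x))) = (LINT x|\<mu>. Im (f x))"
      using R[rule_format, OF s, of "\<lambda>x. Re (f x)"] R[rule_format, OF s, of "\<lambda>x. Im (f x)"]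
      by (auto intro: continuous_intros)
    then show "(LINT x|\<mu>. apply_bcontfun (koopman act s f) x) = (LINT x|\<mu>. apply_bcontfun f x)"
      using i by (intro complex_eqI) (simp_all add: koopman_apply[where act = act and s = s, OF K c[OF s]] flip: integral_Re integral_Im)
  qed
  ultimately show ?thesis by (auto simp: invariant_measures_def)
qed

text \<open>Invariance makes composition with \<open>\<sigma>\<close> an isometry for the mean.
  Hence \<open>f\<close> composed with \<open>\<sigma>\<close> satisfies the condition under
  \<open>SOME\<close>, by density of continuous functions. Conversely, whatever function was chosen,
  its own approximating sequence shows that its distance to this composition is at most the sum of
  two null sequences.\<close>

lemma L1_extension_AE:
  fixes \<mu> :: "'k::t2_space measure"
  assumes K: "compact (UNIV :: 'k set)" and \<mu>: "regular_probability_measure \<mu>"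
    and \<sigma>: "continuous_on UNIV \<sigma>" and distr: "distr \<mu> borel \<sigma> = \<mu>"
    and S: "\<And>h x. apply_bcontfun (S h) x = apply_bcontfun h (\<sigma> x)"
    and f: "integrable \<mu> f"
  shows "AE x in \<mu>. L1_extension \<mu> S f x = f (\<sigma> x)"
proof -
  interpret prob_space \<mu> using \<mu> by (rule regular_prob_space)
  note sets = regular_sets[OF \<mu>] and space = regular_space[OF \<mu>]
  have mb: "\<sigma> \<in> measurable \<mu> borel"
    using borel_measurable_continuous_onI[OF \<sigma>] by (simp cong: measurable_cong_sets add: sets)
  have int_comp: "integrable \<mu> (\<lambda>x. u (\<sigma> x))" if "integrable \<mu> u" for u :: "'k \<Rightarrow> complex"
    using integrable_distr[OF mb, of u] that distr by simp
  have norm_comp: "(LINT x|\<mu>. cmod (u (\<sigma> x))) = (LINT x|\<mu>. cmod (u x))" if "integrable \<mu> u"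
    for u :: "'k \<Rightarrow> complex"
  proof -
    have "u \<in> borel_measurable borel"
      using that by (auto simp: sets cong: measurable_cong_sets dest!: borel_measurable_integrable)
    then show ?thesis using integral_distr[OF mb, of "\<lambda>x. cmod (u x)"] distr by simp
  qed
  have int: "integrable \<mu> (apply_bcontfun h)" for h :: "'k \<Rightarrow>\<^sub>C complex"
    using continuous_integrable[OF K prob_space_axioms sets] by auto
  have S_comp: "(LINT x|\<mu>. cmod (apply_bcontfun (S h) x - f (\<sigma> x))) = (LINT x|\<mu>. cmod (apply_bcontfun h x - f x))"
    for h :: "'k \<Rightarrow>\<^sub>C complex"
    using norm_comp[of "\<lambda>x. apply_bcontfun h x - f x"] int[of h] f by (simp add: S)
  define P where "P g \<longleftrightarrow> integrable \<mu> g \<and>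
        (\<exists>h :: nat \<Rightarrow> ('k \<Rightarrow>\<^sub>C complex).
           (\<lambda>n. LINT x|\<mu>. cmod (apply_bcontfun (h n) x - f x)) \<longlonglongrightarrow> 0 \<and>
           (\<lambda>n. LINT x|\<mu>. cmod (apply_bcontfun (S (h n)) x - g x)) \<longlonglongrightarrow> 0)" for g
  have "\<exists>h :: 'k \<Rightarrow>\<^sub>C complex. (LINT x|\<mu>. cmod (apply_bcontfun h x - f x)) < 1 / Suc n" for n
  proof -
    obtain h where h: "continuous_on UNIV h" "(LINT x|\<mu>. norm (h x - f x)) < 1 / Suc n"
      using continuous_L1_dense[OF K \<mu> f, of "1 / Suc n"] by auto
    then show ?thesis
      by (intro exI[of _ "Bcontfun h"]) (simp add: apply_bcontfun_Bcontfun[OF K h(1)])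
  qed
  then obtain h :: "nat \<Rightarrow> 'k \<Rightarrow>\<^sub>C complex"
    where h: "\<And>n. (LINT x|\<mu>. cmod (apply_bcontfun (h n) x - f x)) < 1 / Suc n" by metis
  have "(\<lambda>n. LINT x|\<mu>. cmod (apply_bcontfun (h n) x - f x)) \<longlonglongrightarrow> 0"
    by (rule tendsto_sandwich[OF _ _ tendsto_const LIMSEQ_inverse_real_of_nat])
      (use h in \<open>auto simp: inverse_eq_divide intro!: always_eventually less_imp_le\<close>)
  then have "P (\<lambda>x. f (\<sigma> x))"
    using int_comp[OF f] by (auto simp: P_def S_comp intro!: exI[of _ h])
  then have "P (SOME g. P g)" by (rule someI[where P = P])
  then have "P (L1_extension \<mu> S f)" by (simp add: L1_extension_def P_def)
  then obtain k :: "nat \<Rightarrow> 'k \<Rightarrow>\<^sub>C complex"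
    where gi: "integrable \<mu> (L1_extension \<mu> S f)"
      and k: "(\<lambda>n. LINT x|\<mu>. cmod (apply_bcontfun (k n) x - f x)) \<longlonglongrightarrow> 0"
        "(\<lambda>n. LINT x|\<mu>. cmod (apply_bcontfun (S (k n)) x - L1_extension \<mu> S f x)) \<longlonglongrightarrow> 0"
    unfolding P_def by blast
  let ?g = "L1_extension \<mu> S f"
  have le: "(LINT x|\<mu>. cmod (?g x - f (\<sigma> x))) \<le>
      (LINT x|\<mu>. cmod (apply_bcontfun (S (k n)) x - ?g x)) + (LINT x|\<mu>. cmod (apply_bcontfun (k n) x - f x))"
    for n
  proof -
    have "(LINT x|\<mu>. cmod (?g x - f (\<sigma> x))) \<le>
      (LINT x|\<mu>. cmod (apply_bcontfun (S (k n)) x - ?g x) + cmod (apply_bcontfun (S (k n)) x - f (\<sigma> x)))"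
      using gi int_comp[OF f] int[of "S (k n)"]
    proof (intro integral_mono)
      show "cmod (?g x - f (\<sigma> x)) \<le> cmod (apply_bcontfun (S (k n)) x - ?g x) +
          cmod (apply_bcontfun (S (k n)) x - f (\<sigma> x))" for x
        using norm_triangle_ineq4[of "apply_bcontfun (S (k n)) x - f (\<sigma> x)" "apply_bcontfun (S (k n)) x - ?g x"]
        by simp
    qed auto
    also have "\<dots> = (LINT x|\<mu>. cmod (apply_bcontfun (S (k n)) x - ?g x)) +
        (LINT x|\<mu>. cmod (apply_bcontfun (S (k n)) x - f (\<sigma> x)))"
      using gi int_comp[OF f] int[of "S (k n)"] by simp
    finally show ?thesis by (simp add: S_comp)
  qed
  have "(LINT x|\<mu>. cmod (?g x - f (\<sigma> x))) \<le> 0"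
    using LIMSEQ_le_const[OF tendsto_add[OF k(2) k(1)], of "LINT x|\<mu>. cmod (?g x - f (\<sigma> x))"] le by auto
  then have "(LINT x|\<mu>. cmod (?g x - f (\<sigma> x))) = 0" by (intro antisym) auto
  then have "AE x in \<mu>. cmod (?g x - f (\<sigma> x)) = 0"
    using gi int_comp[OF f] by (subst (asm) integral_nonneg_eq_0_iff_AE) auto
  then show ?thesis by auto
qed

text \<open>Expectation under \<open>\<mu>\<close> conditioned on \<open>A\<close>; the value 0 at
  discontinuous functions is what \<open>state\<close> demands.\<close>

definition conditional_state :: "'k::topological_space measure \<Rightarrow> 'k set \<Rightarrow> ('k \<Rightarrow> real) \<Rightarrow> real" where
  "conditional_state \<mu> A f =
    (if continuous_on UNIV f then (LINT x|\<mu>. indicator A x * f x) / measure \<mu> A else 0)"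

text \<open>Almost everywhere the indicator of \<open>A\<close> may be replaced by its composition
  with \<open>\<sigma>\<close>; then the whole integrand is composed with \<open>\<sigma>\<close>
  and the invariance of \<open>\<mu>\<close> applies.\<close>

lemma conditional_state_invariant:
  fixes \<mu> :: "'k::t2_space measure"
  assumes K: "compact (UNIV :: 'k set)" and \<mu>: "regular_probability_measure \<mu>"
    and \<Sigma>: "\<And>\<sigma>. \<sigma> \<in> \<Sigma> \<Longrightarrow> continuous_on UNIV \<sigma>" "\<And>\<sigma>. \<sigma> \<in> \<Sigma> \<Longrightarrow> distr \<mu> borel \<sigma> = \<mu>"
    and A: "A \<in> sets borel" "0 < measure \<mu> A"
    and inv: "\<And>\<sigma>. \<sigma> \<in> \<Sigma> \<Longrightarrow> AE x in \<mu>. \<sigma> x \<in> A \<longleftrightarrow> x \<in> A"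
  shows "conditional_state \<mu> A \<in> invariant_states \<Sigma>"
proof -
  interpret prob_space \<mu> using \<mu> by (rule regular_prob_space)
  note sets = regular_sets[OF \<mu>] and space = regular_space[OF \<mu>]
  have int: "integrable \<mu> (\<lambda>x. indicator A x * f x)" if "continuous_on UNIV f" for f :: "'k \<Rightarrow> real"
    using integrable_mult_indicator[OF _ continuous_integrable[OF K prob_space_axioms sets that], of A] A(1)
    by (simp add: sets)
  have "conditional_state \<mu> A (\<lambda>x. f (\<sigma> x)) = conditional_state \<mu> A f"
    if s: "\<sigma> \<in> \<Sigma>" and f: "continuous_on UNIV f" for \<sigma> f
  proof -
    have cf: "continuous_on UNIV (\<lambda>x. f (\<sigma> x))"
      using continuous_on_compose2[OF f \<Sigma>(1)[OF s]] by simp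
    have mb: "\<sigma> \<in> measurable \<mu> borel"
      using borel_measurable_continuous_onI[OF \<Sigma>(1)[OF s]] by (simp cong: measurable_cong_sets add: sets)
    have mf: "(\<lambda>x. indicator A x * f x) \<in> borel_measurable borel"
      using A(1) borel_measurable_continuous_onI[OF f] by measurable
    have "(LINT x|\<mu>. indicator A x * f (\<sigma> x)) = (LINT x|\<mu>. indicator A (\<sigma> x) * f (\<sigma> x))"
    proof (rule integral_cong_AE)
      show "(\<lambda>x. indicator A x * f (\<sigma> x)) \<in> borel_measurable \<mu>" using int[OF cf] by auto
      show "(\<lambda>x. indicator A (\<sigma> x) * f (\<sigma> x)) \<in> borel_measurable \<mu>"
        using measurable_compose[OF mb mf] by simp
      show "AE x in \<mu>. indicator A x * f (\<sigma> x) = indicator A (\<sigma> x) * f (\<sigma> x)"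
        using inv[OF s] by eventually_elim (auto simp: indicator_def)
    qed
    also have "\<dots> = (LINT x|\<mu>. indicator A x * f x)"
      using integral_distr[OF mb mf] \<Sigma>(2)[OF s] by simp
    finally show ?thesis using f cf by (simp add: conditional_state_def)
  qed
  moreover have "state (conditional_state \<mu> A)"
    unfolding state_def
  proof (intro conjI allI impI)
    fix f g :: "'k \<Rightarrow> real" and c :: real assume f: "continuous_on UNIV f"
    show "conditional_state \<mu> A (\<lambda>x. c * f x) = c * conditional_state \<mu> A f"
      using f int[OF f] by (simp add: conditional_state_def continuous_on_mult_left mult.left_commute)
    assume g: "continuous_on UNIV g"
    show "conditional_state \<mu> A (\<lambda>x. f x + g x) = conditional_state \<mu> A f + conditional_state \<mu> A g"
      using f g int[OF f] int[OF g]
      by (simp add: conditional_state_def continuous_on_add distrib_left add_divide_distrib)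
  next
    fix f :: "'k \<Rightarrow> real" assume "continuous_on UNIV f" "\<forall>x. 0 \<le> f x"
    then show "0 \<le> conditional_state \<mu> A f"
      by (auto simp: conditional_state_def intro!: divide_nonneg_nonneg integral_nonneg)
  next
    show "conditional_state \<mu> A (\<lambda>x. 1) = 1"
      using A by (simp add: conditional_state_def space)
  qed (simp add: conditional_state_def)
  ultimately show ?thesis by (simp add: invariant_states_def)
qed

text \<open>If \<open>0 < a < 1\<close>, then \<open>\<phi>\<close> is the mixture of the states
  conditioned on \<open>A\<close> and on \<open>- A\<close> with weights \<open>a\<close> and
  \<open>1 - a\<close>. Extremality makes the first one equal to \<open>\<phi>\<close>, so
  \<open>A\<close> is uncorrelated with every continuous function. Approximating the indicator of
  \<open>A\<close> itself by continuous functions gives \<open>a = a * a\<close>.\<close>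

lemma extreme_state_zero_one:
  fixes \<mu> :: "'k::t2_space measure"
  assumes K: "compact (UNIV :: 'k set)" and \<mu>: "regular_probability_measure \<mu>"
    and \<Sigma>: "\<And>\<sigma>. \<sigma> \<in> \<Sigma> \<Longrightarrow> continuous_on UNIV \<sigma>" "\<And>\<sigma>. \<sigma> \<in> \<Sigma> \<Longrightarrow> distr \<mu> borel \<sigma> = \<mu>"
    and \<phi>: "extreme_in (invariant_states \<Sigma>) \<phi>"
    and rep: "\<And>f. continuous_on UNIV f \<Longrightarrow> (LINT x|\<mu>. f x) = \<phi> f"
    and A: "A \<in> sets borel"
    and inv: "\<And>\<sigma>. \<sigma> \<in> \<Sigma> \<Longrightarrow> AE x in \<mu>. \<sigma> x \<in> A \<longleftrightarrow> x \<in> A"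
  shows "measure \<mu> A = 0 \<or> measure \<mu> A = 1"
proof (rule ccontr)
  interpret prob_space \<mu> using \<mu> by (rule regular_prob_space)
  note sets = regular_sets[OF \<mu>] and space = regular_space[OF \<mu>]
  assume contr: "\<not> (measure \<mu> A = 0 \<or> measure \<mu> A = 1)"
  define a where "a = measure \<mu> A"
  have a: "0 < a" "a < 1"
    using contr measure_nonneg[of \<mu> A] prob_le_1[of A] unfolding a_def by linarith+
  have ca: "measure \<mu> (- A) = 1 - a"
    using prob_compl[of A] A by (simp add: a_def space sets Compl_eq_Diff_UNIV)
  have 1: "conditional_state \<mu> A \<in> invariant_states \<Sigma>"
    using a inv A by (intro conditional_state_invariant[OF K \<mu> \<Sigma>]) (auto simp: a_def)
  have 2: "conditional_state \<mu> (- A) \<in> invariant_states \<Sigma>"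
    using a inv A ca by (intro conditional_state_invariant[OF K \<mu> \<Sigma>]) auto
  have int: "integrable \<mu> f" if "continuous_on UNIV f" for f :: "'k \<Rightarrow> real"
    using continuous_integrable[OF K prob_space_axioms sets that] .
  have intA: "integrable \<mu> (\<lambda>x. indicator B x * f x)" if "B \<in> sets borel" "integrable \<mu> f"
    for B and f :: "'k \<Rightarrow> real"
    using integrable_mult_indicator[OF _ that(2), of B] that(1) by (simp add: sets)
  have "\<phi> = (\<lambda>f. a * conditional_state \<mu> A f + (1 - a) * conditional_state \<mu> (- A) f)"
  proof
    fix f :: "'k \<Rightarrow> real"
    show "\<phi> f = a * conditional_state \<mu> A f + (1 - a) * conditional_state \<mu> (- A) f"
    proof (cases "continuous_on UNIV f")
      case True
      have "\<phi> f = (LINT x|\<mu>. indicator A x * f x + indicator (- A) x * f x)"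
        unfolding rep[OF True, symmetric] by (rule Bochner_Integration.integral_cong) (auto simp: indicator_def)
      also have "\<dots> = (LINT x|\<mu>. indicator A x * f x) + (LINT x|\<mu>. indicator (- A) x * f x)"
        using intA[OF A int[OF True]] intA[of "- A", OF _ int[OF True]] A by simp
      finally show ?thesis using True a ca by (simp add: conditional_state_def flip: a_def)
    next
      case False
      then show ?thesis
        using \<phi> by (simp add: conditional_state_def extreme_in_def invariant_states_def state_def)
    qed
  qed
  then have "conditional_state \<mu> A = \<phi>"
    using \<phi> 1 2 a unfolding extreme_in_def by blast
  then have key: "(LINT x|\<mu>. indicator A x * f x) = a * (LINT x|\<mu>. f x)" if "continuous_on UNIV f" for f
    using that a rep[OF that] by (auto simp: conditional_state_def a_def[symmetric] field_simps fun_eq_iff split: if_splits)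
  have iA: "integrable \<mu> (indicator A :: 'k \<Rightarrow> real)" using A by (simp add: sets less_top[symmetric])
  \<comment> \<open>The number \<open>a * (LINT x|\<mu>. h x)\<close> is within \<open>e\<close> of
    both candidates: of \<open>a\<close>, since by \<open>key\<close> it is the integral of
    \<open>h\<close> over \<open>A\<close>, and of \<open>a * a\<close>, since the integral of
    \<open>h\<close> is close to \<open>a\<close>.\<close>
  have "\<bar>a - a * a\<bar> \<le> 2 * e" if "0 < e" for e
  proof -
    obtain h :: "'k \<Rightarrow> real" where h: "continuous_on UNIV h" "(LINT x|\<mu>. norm (h x - indicator A x)) < e"
      using continuous_L1_dense[OF K \<mu> iA \<open>0 < e\<close>] by blast
    have "\<bar>(LINT x|\<mu>. h x) - a\<bar> = \<bar>LINT x|\<mu>. h x - indicator A x\<bar>"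
      using int[OF h(1)] iA by (simp add: a_def space)
    also have "\<dots> \<le> (LINT x|\<mu>. norm (h x - indicator A x))"
      using integral_norm_bound[of \<mu> "\<lambda>x. h x - indicator A x"] by simp
    finally have 1: "\<bar>(LINT x|\<mu>. h x) - a\<bar> \<le> e" using h(2) by simp
    have "\<bar>(LINT x|\<mu>. indicator A x * h x) - a\<bar> = \<bar>LINT x|\<mu>. indicator A x * (h x - indicator A x)\<bar>"
    proof -
      have "(LINT x|\<mu>. indicator A x * (h x - indicator A x)) = (LINT x|\<mu>. indicator A x * h x - indicator A x)"
        by (rule Bochner_Integration.integral_cong) (auto simp: indicator_def)
      then show ?thesis using intA[OF A int[OF h(1)]] iA by (simp add: a_def space)
    qed
    also have "\<dots> \<le> (LINT x|\<mu>. norm (indicator A x * (h x - indicator A x)))"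
      using integral_norm_bound[of \<mu> "\<lambda>x. indicator A x * (h x - indicator A x)"] by simp
    also have "\<dots> \<le> (LINT x|\<mu>. norm (h x - indicator A x))"
    proof (intro integral_mono integrable_norm)
      show "integrable \<mu> (\<lambda>x. h x - indicator A x)" using int[OF h(1)] iA by simp
      then show "integrable \<mu> (\<lambda>x. indicator A x * (h x - indicator A x))" by (rule intA[OF A])
    qed (auto simp: indicator_def)
    finally have "\<bar>a * (LINT x|\<mu>. h x) - a\<bar> \<le> e" using h(2) key[OF h(1)] by simp
    moreover have "\<bar>a * (LINT x|\<mu>. h x) - a * a\<bar> \<le> e"
    proof -
      have "\<bar>a * (LINT x|\<mu>. h x) - a * a\<bar> = a * \<bar>(LINT x|\<mu>. h x) - a\<bar>"
        using a by (simp add: abs_mult flip: right_diff_distrib)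
      also have "\<dots> \<le> 1 * \<bar>(LINT x|\<mu>. h x) - a\<bar>" using a by (intro mult_right_mono) auto
      finally show ?thesis using 1 by simp
    qed
    ultimately show ?thesis by linarith
  qed
  \<comment> \<open>For this \<open>e\<close> the bound reads
    \<open>a - a * a \<le> (a - a * a) / 2\<close>, while the left side is positive.\<close>
  from this[of "(a - a * a) / 4"] show False using a by (simp add: abs_if split: if_splits)
qed

text \<open>One level set is enough, the one at the mean \<open>m\<close>. By the zero-one law
  either \<open>u \<le> m\<close> or \<open>u > m\<close> holds almost everywhere; in both cases the
  deviation from the mean has constant sign and integral 0, so it vanishes almost
  everywhere.\<close>

lemma extreme_state_invariant_constant:
  fixes \<mu> :: "'k::t2_space measure" and u :: "'k \<Rightarrow> real"
  assumes K: "compact (UNIV :: 'k set)" and \<mu>: "regular_probability_measure \<mu>"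
    and \<Sigma>: "\<And>\<sigma>. \<sigma> \<in> \<Sigma> \<Longrightarrow> continuous_on UNIV \<sigma>" "\<And>\<sigma>. \<sigma> \<in> \<Sigma> \<Longrightarrow> distr \<mu> borel \<sigma> = \<mu>"
    and \<phi>: "extreme_in (invariant_states \<Sigma>) \<phi>"
    and rep: "\<And>f. continuous_on UNIV f \<Longrightarrow> (LINT x|\<mu>. f x) = \<phi> f"
    and u: "integrable \<mu> u"
    and inv: "\<And>\<sigma>. \<sigma> \<in> \<Sigma> \<Longrightarrow> AE x in \<mu>. u (\<sigma> x) = u x"
  shows "AE x in \<mu>. u x = (LINT x|\<mu>. u x)"
proof -
  interpret prob_space \<mu> using \<mu> by (rule regular_prob_space)
  note sets = regular_sets[OF \<mu>] and space = regular_space[OF \<mu>]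
  define m where "m = (LINT x|\<mu>. u x)"
  define A where "A = {x. m < u x}"
  have "u \<in> borel_measurable borel"
    using u by (auto simp: sets cong: measurable_cong_sets dest!: borel_measurable_integrable)
  then have A: "A \<in> sets borel" unfolding A_def by measurable
  have "AE x in \<mu>. \<sigma> x \<in> A \<longleftrightarrow> x \<in> A" if "\<sigma> \<in> \<Sigma>" for \<sigma>
    using inv[OF that] by eventually_elim (simp add: A_def)
  then consider "prob A = 0" | "prob A = 1"
    using extreme_state_zero_one[OF K \<mu> \<Sigma> \<phi> rep A] by blast
  then show ?thesis
  proof cases
    case 1
    then have "AE x in \<mu>. x \<notin> A" using A by (subst AE_iff_measurable[of A]) (auto simp: sets space emeasure_eq_measure)
    then have "AE x in \<mu>. 0 \<le> m - u x" by eventually_elim (simp add: A_def)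
    moreover have "(LINT x|\<mu>. m - u x) = 0" using u prob_space by (simp add: m_def)
    ultimately have "AE x in \<mu>. m - u x = 0"
      using u by (subst (asm) integral_nonneg_eq_0_iff_AE) auto
    then show ?thesis by (auto simp: m_def)
  next
    case 2
    then have "AE x in \<mu>. x \<in> A" using A by (subst prob_eq_1[symmetric]) (auto simp: sets)
    then have "AE x in \<mu>. 0 \<le> u x - m" by eventually_elim (simp add: A_def)
    moreover have "(LINT x|\<mu>. u x - m) = 0" using u prob_space by (simp add: m_def)
    ultimately have "AE x in \<mu>. u x - m = 0"
      using u by (subst (asm) integral_nonneg_eq_0_iff_AE) auto
    then show ?thesis by (auto simp: m_def)
  qed
qed

section \<open>Averages along the action\<close>

locale haar_action =
  fixes H :: "'g::{topological_group_add, t2_space} set"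
    and lam :: "'g measure"
    and act :: "'g \<Rightarrow> 'k::t2_space \<Rightarrow> 'k"
  assumes K: "compact (UNIV :: 'k set)"
    and haar: "left_haar_measure lam"
    and semigroup: "\<And>s t. s \<in> H \<Longrightarrow> t \<in> H \<Longrightarrow> s + t \<in> H"
    and action: "continuous_semigroup_action H act"
begin

lemma sets_lam: "sets lam = sets borel" and space_lam: "space lam = UNIV"
  using haar sets_eq_imp_space_eq[of lam borel] by (auto simp: left_haar_measure_def)

lemma compact_emeasure: "compact C \<Longrightarrow> emeasure lam C < \<infinity>"
  using haar by (auto simp: left_haar_measure_def)

lemma compact_sets: "compact C \<Longrightarrow> C \<in> sets lam" for C :: "'g set"
  using compact_imp_closed[of C] by (auto simp: sets_lam)

lemma act_add: "s \<in> H \<Longrightarrow> t \<in> H \<Longrightarrow> act (s + t) x = act s (act t x)"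
  and continuous_act_pair: "continuous_on (H \<times> UNIV) (\<lambda>(s, x). act s x)"
  using action by (auto simp: continuous_semigroup_action_def)

lemma continuous_act:
  assumes "s \<in> H"
  shows "continuous_on UNIV (act s)"
proof -
  have "continuous_on UNIV (\<lambda>x :: 'k. (s, x))" by (intro continuous_intros)
  from continuous_on_compose2[OF continuous_act_pair this] show ?thesis
    using assms by auto
qed

lemma continuous_orbit:
  assumes "C \<subseteq> H"
  shows "continuous_on C (\<lambda>s. act s x)"
proof -
  have "continuous_on C (\<lambda>s. (s, x))" by (intro continuous_intros)
  from continuous_on_compose2[OF continuous_act_pair this] show ?thesis
    using assms by auto
qed

lemma continuous_orbit_fun:
  "C \<subseteq> H \<Longrightarrow> continuous_on UNIV f \<Longrightarrow> continuous_on C (\<lambda>s. f (act s x))"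
  using continuous_on_compose2[OF _ continuous_orbit, of UNIV f C] by auto

lemma continuous_koopman:
  "s \<in> H \<Longrightarrow> continuous_on UNIV f \<Longrightarrow> continuous_on UNIV (\<lambda>x. f (act s x))"
  using continuous_on_compose2[OF _ continuous_act, of UNIV f s] by auto

lemma orbit_integrable:
  fixes f :: "'k \<Rightarrow> real"
  assumes "compact C" "C \<subseteq> H" "continuous_on UNIV f"
  shows "integrable lam (\<lambda>s. indicator C s * f (act s x))"
proof -
  obtain B where B: "\<And>x. \<bar>f x\<bar> \<le> B" using compact_continuous_bounded[OF K assms(3)] by metis
  have "(\<lambda>s. indicator C s *\<^sub>R f (act s x)) \<in> borel_measurable borel"
    using compact_sets[OF assms(1)] continuous_orbit_fun[OF assms(2,3)]
    by (intro borel_measurable_continuous_on_indicator) (auto simp: sets_lam)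
  then have "(\<lambda>s. indicator C s * f (act s x)) \<in> borel_measurable lam"
    by (simp cong: measurable_cong_sets add: sets_lam)
  then show ?thesis
    using B compact_sets[OF assms(1)] compact_emeasure[OF assms(1)]
    by (intro integrableI_bounded_set[where A = C and B = B]) (auto simp: indicator_def)
qed

lemma indicator_integrable: "compact C \<Longrightarrow> integrable lam (indicator C :: 'g \<Rightarrow> real)"
  using compact_sets compact_emeasure by simp

definition avg :: "'g set \<Rightarrow> ('k \<Rightarrow> real) \<Rightarrow> 'k \<Rightarrow> real" where
  "avg C f x = (LINT s|lam. indicator C s * f (act s x)) / measure lam C"

text \<open>As \<open>K\<close> is compact, \<open>f (act s x)\<close> depends on \<open>s\<close>
  continuously in a way that is uniform in \<open>x\<close>. Finitely many neighborhoods on which it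
  varies by at most \<open>e\<close> cover \<open>C\<close>; cutting \<open>C\<close> into disjoint
  pieces accordingly turns the average into a Riemann sum whose weights are the relative measures of
  the pieces.\<close>

lemma avg_convex_approx:
  assumes C: "compact C" "C \<subseteq> H" "0 < measure lam C" and f: "continuous_on UNIV f" and e: "0 < e"
  obtains m :: nat and w :: "nat \<Rightarrow> real" and s :: "nat \<Rightarrow> 'g" where
    "\<And>i. i < m \<Longrightarrow> s i \<in> H" "(\<Sum>i<m. w i) = 1"
    "\<And>x. \<bar>avg C f x - (\<Sum>i<m. w i * f (act (s i) x))\<bar> \<le> e"
proof -
  have cf: "continuous_on (H \<times> UNIV) (\<lambda>p. f (case p of (s, x) \<Rightarrow> act s x))"
    using continuous_on_compose2[OF f continuous_act_pair] by simp
  have "\<exists>N. open N \<and> s \<in> N \<and> (\<forall>t\<in>N \<inter> H. \<forall>x. \<bar>f (act t x) - f (act s x)\<bar> \<le> e)" if "s \<in> C" for s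
  proof -
    have "s \<in> H" using that C by auto
    then obtain N where "s \<in> N" "open N"
      "\<forall>t\<in>N \<inter> H. \<forall>x\<in>UNIV. dist (f (case (t, x) of (s, x) \<Rightarrow> act s x)) (f (case (s, x) of (s, x) \<Rightarrow> act s x)) \<le> e"
      using continuous_on_prod_compactE[OF cf K _ e] by metis
    then show ?thesis by (auto simp: dist_real_def)
  qed
  then obtain N where N: "\<And>s. s \<in> C \<Longrightarrow> open (N s)" "\<And>s. s \<in> C \<Longrightarrow> s \<in> N s"
    "\<And>s t x. s \<in> C \<Longrightarrow> t \<in> N s \<inter> H \<Longrightarrow> \<bar>f (act t x) - f (act s x)\<bar> \<le> e" by metis
  obtain D where D: "D \<subseteq> C" "finite D" "C \<subseteq> (\<Union>s\<in>D. N s)"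
    using compactE_image[OF C(1), of C N] N by blast
  define m where "m = card D"
  obtain s where s: "bij_betw s {..<m} D"
    using ex_bij_betw_nat_finite[OF D(2)] by (auto simp: m_def atLeast0LessThan)
  have sC: "s i \<in> C" if "i < m" for i using bij_betwE[OF s] that D by auto
  \<comment> \<open>The covering sets are made disjoint in the order of the enumeration
    \<open>s\<close> of \<open>D\<close>. Only indices below \<open>m\<close> matter; beyond them
    \<open>s\<close> is unspecified.\<close>
  define A where "A i = disjointed (\<lambda>i. C \<inter> N (s i)) i" for i
  have AN: "A i \<subseteq> C \<inter> N (s i)" for i
    unfolding A_def by (rule disjointed_subset)
  have dis: "disjoint_family A" unfolding A_def by (rule disjoint_family_disjointed)
  have cover: "C = (\<Union>i<m. A i)"
  proof -
    have "(\<Union>i<m. A i) = (\<Union>i<m. C \<inter> N (s i))"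
      using finite_UN_disjointed_eq[of "\<lambda>i. C \<inter> N (s i)" m] by (simp add: A_def atLeast0LessThan)
    also have "\<dots> = C \<inter> (\<Union>t\<in>s ` {..<m}. N t)" by blast
    finally show ?thesis using D s by (auto simp: bij_betw_def)
  qed
  have Am: "A i \<in> sets lam" if "i < m" for i
    unfolding A_def disjointed_def
    using that sC N(1) compact_sets[OF C(1)] by (intro sets.Diff sets.finite_UN sets.Int) (auto simp: sets_lam)
  have Afin: "emeasure lam (A i) < \<infinity>" if "i < m" for i
    using emeasure_mono[of "A i" C lam] AN[of i] compact_sets[OF C(1)] compact_emeasure[OF C(1)]
    by (auto intro: le_less_trans)
  have Ai: "integrable lam (indicator (A i) :: 'g \<Rightarrow> real)" if "i < m" for i
    using Am[OF that] Afin[OF that] by simp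
  have pick: "(\<Sum>i<m. indicator (A i) t * c i) = (c j :: real)" if "j < m" "t \<in> A j" for j t c
  proof -
    have "indicator (A i) t * c i = (if i = j then c j else 0)" for i
      using dis that by (auto simp: disjoint_family_on_def indicator_def)
    then show ?thesis using that by simp
  qed
  define w where "w i = measure lam (A i) / measure lam C" for i
  have "(\<Sum>i<m. measure lam (A i)) = (\<Sum>i<m. LINT t|lam. indicator (A i) t)"
    by (simp add: space_lam)
  also have "\<dots> = (LINT t|lam. (\<Sum>i<m. indicator (A i) t))"
    using Ai by (subst Bochner_Integration.integral_sum) auto
  also have "\<dots> = (LINT t|lam. indicator C t)"
  proof (rule Bochner_Integration.integral_cong)
    fix t
    show "(\<Sum>i<m. indicator (A i) t) = (indicator C t :: real)"
    proof (cases "t \<in> C")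
      case True
      then obtain j where "j < m" "t \<in> A j" using cover by auto
      then show ?thesis using pick[of j t "\<lambda>_. 1"] True by simp
    next
      case False
      then show ?thesis using AN by (auto simp: indicator_def intro!: sum.neutral)
    qed
  qed simp
  also have "\<dots> = measure lam C" by (simp add: space_lam)
  finally have w1: "(\<Sum>i<m. w i) = 1"
    using C(3) by (simp add: w_def flip: sum_divide_distrib)
  have "\<bar>avg C f x - (\<Sum>i<m. w i * f (act (s i) x))\<bar> \<le> e" for x
  proof -
    let ?d = "\<lambda>t. indicator C t * f (act t x) - (\<Sum>i<m. indicator (A i) t * f (act (s i) x))"
    have int: "integrable lam (\<lambda>t. indicator C t * f (act t x))"
      by (rule orbit_integrable[OF C(1,2) f])
    have int2: "integrable lam (\<lambda>t. \<Sum>i<m. indicator (A i) t * f (act (s i) x))"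
      using Ai by (intro Bochner_Integration.integrable_sum integrable_mult_left) auto
    have "(LINT t|lam. (\<Sum>i<m. indicator (A i) t * f (act (s i) x))) = (\<Sum>i<m. measure lam (A i) * f (act (s i) x))"
      using Ai by (subst Bochner_Integration.integral_sum) (auto simp: space_lam)
    then have eq: "(LINT t|lam. ?d t) = (avg C f x - (\<Sum>i<m. w i * f (act (s i) x))) * measure lam C"
      using int int2 C(3) by (simp add: avg_def w_def left_diff_distrib sum_distrib_right)
    have "\<bar>?d t\<bar> \<le> e * indicator C t" for t
    proof (cases "t \<in> C")
      case True
      then obtain j where j: "j < m" "t \<in> A j" using cover by auto
      then have "t \<in> N (s j) \<inter> H" using AN[of j] C(2) by auto
      then show ?thesis using pick[OF j] N(3)[OF sC[OF j(1)], of t x] True by simp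
    next
      case False
      have "(\<Sum>i<m. indicator (A i) t * f (act (s i) x)) = 0"
        using AN False by (intro sum.neutral) (auto simp: indicator_def)
      then show ?thesis using False by simp
    qed
    then have "\<bar>LINT t|lam. ?d t\<bar> \<le> (LINT t|lam. e * indicator C t)"
      using int int2 indicator_integrable[OF C(1)]
      by (intro order_trans[OF integral_abs_bound] integral_mono) auto
    also have "\<dots> = e * measure lam C" by (simp add: space_lam)
    finally show ?thesis using C(3) unfolding eq by (simp add: abs_mult)
  qed
  then show thesis using that[of m s w] sC C(2) w1 by blast
qed

lemma continuous_avg:
  assumes C: "compact C" "C \<subseteq> H" "0 < measure lam C" and f: "continuous_on UNIV f"
  shows "continuous_on UNIV (avg C f)"
proof -
  have "\<exists>g. continuous_on UNIV g \<and> (\<forall>x. \<bar>avg C f x - g x\<bar> \<le> 1 / Suc n)" for n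
  proof -
    have "0 < 1 / real (Suc n)" by simp
    then obtain m :: nat and w s where *: "\<And>i. i < m \<Longrightarrow> s i \<in> H"
      "\<And>x. \<bar>avg C f x - (\<Sum>i<m. w i * f (act (s i) x))\<bar> \<le> 1 / Suc n"
      using avg_convex_approx[OF C f, of "1 / Suc n"] by metis
    have "continuous_on UNIV (\<lambda>x. \<Sum>i<m. w i * f (act (s i) x))"
      using continuous_koopman[OF *(1) f] by (intro continuous_intros) auto
    then show ?thesis using * by blast
  qed
  then obtain g where g: "\<And>n. continuous_on UNIV (g n)" "\<And>n x. \<bar>avg C f x - g n x\<bar> \<le> 1 / Suc n"
    by metis
  have "uniform_limit UNIV g (avg C f) sequentially"
  proof (rule uniform_limitI)
    fix e :: real assume "0 < e"
    then obtain n0 where n0: "1 / Suc n0 < e" by (rule nat_approx_posE)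
    have "\<forall>x\<in>UNIV. dist (g n x) (avg C f x) < e" if "n0 \<le> n" for n
    proof
      fix x
      have "1 / real (Suc n) \<le> 1 / Suc n0" using that by (simp add: field_simps)
      then show "dist (g n x) (avg C f x) < e"
        using g(2)[of x n] n0 by (simp add: dist_real_def abs_minus_commute)
    qed
    then show "\<forall>\<^sub>F n in sequentially. \<forall>x\<in>UNIV. dist (g n x) (avg C f x) < e"
      by (auto simp: eventually_sequentially)
  qed
  then show ?thesis
    using g(1) by (intro uniform_limit_theorem[where F = sequentially]) auto
qed

text \<open>The interchange of the two integrals: for a finite combination of translates with
  weights of sum 1 the identity is exact by invariance, and the uniform error \<open>e\<close>
  survives integration against a probability measure.\<close>

lemma integral_avg:
  assumes C: "compact C" "C \<subseteq> H" "0 < measure lam C" and f: "continuous_on UNIV f"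
    and \<mu>: "prob_space \<mu>" "sets \<mu> = sets borel"
    and inv: "\<And>s. s \<in> H \<Longrightarrow> (LINT x|\<mu>. f (act s x)) = (LINT x|\<mu>. f x)"
  shows "(LINT x|\<mu>. avg C f x) = (LINT x|\<mu>. f x)"
proof -
  interpret prob_space \<mu> by fact
  have int: "integrable \<mu> g" if "continuous_on UNIV g" for g :: "'k \<Rightarrow> real"
    using continuous_integrable[OF K \<mu> that] .
  have "\<bar>(LINT x|\<mu>. avg C f x) - (LINT x|\<mu>. f x)\<bar> \<le> 0"
  proof (rule field_le_epsilon)
    fix e :: real assume "0 < e"
    then obtain m :: nat and w s where *: "\<And>i. i < m \<Longrightarrow> s i \<in> H" "(\<Sum>i<m. w i) = 1"
      "\<And>x. \<bar>avg C f x - (\<Sum>i<m. w i * f (act (s i) x))\<bar> \<le> e"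
      using avg_convex_approx[OF C f] by metis
    have ci: "integrable \<mu> (\<lambda>x. w i * f (act (s i) x))" if "i < m" for i
      using int[OF continuous_koopman[OF *(1)[OF that] f]] by simp
    have "(LINT x|\<mu>. (\<Sum>i<m. w i * f (act (s i) x))) = (\<Sum>i<m. w i * (LINT x|\<mu>. f x))"
      using ci inv[OF *(1)] by (subst Bochner_Integration.integral_sum) auto
    also have "\<dots> = (LINT x|\<mu>. f x)" using *(2) by (simp flip: sum_distrib_right)
    finally have "(LINT x|\<mu>. avg C f x) - (LINT x|\<mu>. f x) =
        (LINT x|\<mu>. avg C f x - (\<Sum>i<m. w i * f (act (s i) x)))"
      using int[OF continuous_avg[OF C f]] ci by (subst Bochner_Integration.integral_diff) auto
    also have "\<bar>\<dots>\<bar> \<le> (LINT x|\<mu>. \<bar>avg C f x - (\<Sum>i<m. w i * f (act (s i) x))\<bar>)"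
      by (rule integral_abs_bound)
    also have "\<dots> \<le> (LINT x|\<mu>. e)"
      using int[OF continuous_avg[OF C f]] ci *(3)
      by (intro integral_mono integrable_abs Bochner_Integration.integrable_diff
          Bochner_Integration.integrable_sum) auto
    also have "\<dots> = e" using prob_space by simp
    finally show "\<bar>(LINT x|\<mu>. avg C f x) - (LINT x|\<mu>. f x)\<bar> \<le> 0 + e" by simp
  qed
  then show ?thesis by simp
qed

lemma integral_translate:
  fixes f :: "'g \<Rightarrow> real"
  assumes "f \<in> borel_measurable borel"
  shows "(LINT t|lam. f (s + t)) = (LINT t|lam. f t)"
proof -
  have cont: "continuous_on UNIV ((+) s)" by (intro continuous_intros)
  have mb: "(+) s \<in> measurable lam borel"
    using borel_measurable_continuous_onI[OF cont] by (simp cong: measurable_cong_sets add: sets_lam)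
  have "distr lam borel ((+) s) = lam"
  proof (rule measure_eqI)
    show "sets (distr lam borel ((+) s)) = sets lam" by (simp add: sets_lam)
    fix A assume "A \<in> sets (distr lam borel ((+) s))"
    then have A: "A \<in> sets borel" by simp
    \<comment> \<open>Haar invariance is formulated for images, a push-forward involves preimages;
      the inverse translation connects them.\<close>
    have "(+) s -` A = (+) (- s) ` A"
      by (auto simp: image_iff add.assoc[symmetric]) (metis add.assoc add.left_neutral left_minus)
    then show "emeasure (distr lam borel ((+) s)) A = emeasure lam A"
      using A haar mb by (simp add: emeasure_distr space_lam left_haar_measure_def)
  qed
  then show ?thesis using integral_distr[OF mb assms] by simp
qed

text \<open>Left invariance moves the translation from the function to the set: averaging the
  translated \<open>f\<close> over \<open>C\<close> integrates \<open>f\<close> along the orbit over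
  \<open>s + C\<close>. The two integrands differ only on the symmetric difference, and there by at
  most \<open>B\<close>.\<close>

lemma avg_translate_le:
  assumes C: "compact C" "C \<subseteq> H" "0 < measure lam C" and f: "continuous_on UNIV f"
    and s: "s \<in> H" and B: "\<And>x. \<bar>f x\<bar> \<le> B"
  shows "\<bar>avg C (\<lambda>x. f (act s x)) x - avg C f x\<bar> \<le>
    B * (measure lam (sym_diff C ((+) s ` C)) / measure lam C)"
proof -
  define D where "D = (+) s ` C"
  have cont: "continuous_on C ((+) s)" by (intro continuous_intros)
  have D: "compact D" "D \<subseteq> H"
    using C s semigroup by (auto simp: D_def intro!: compact_continuous_image[OF cont])
  \<comment> \<open>Left translation is injective, so both sides vanish unless
    \<open>t \<in> C\<close>; the action law is thus used only for elements of
    \<open>H\<close>.\<close>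
  have "indicator C t * f (act s (act t x)) = indicator D (s + t) * f (act (s + t) x)" for t
    using act_add[OF s, of t x] C(2) by (auto simp: indicator_def D_def)
  then have shift: "(LINT t|lam. indicator C t * f (act s (act t x))) =
      (LINT t|lam. indicator D (s + t) * f (act (s + t) x))" by simp
  have "(LINT t|lam. indicator C t * f (act s (act t x))) = (LINT t|lam. indicator D t * f (act t x))"
  proof -
    have "(\<lambda>t. indicator D t * f (act t x)) \<in> borel_measurable borel"
      using borel_measurable_integrable[OF orbit_integrable[OF D f, of x]]
      by (simp add: sets_lam cong: measurable_cong_sets)
    from integral_translate[OF this, of s] show ?thesis unfolding shift .
  qed
  then have eq: "(avg C (\<lambda>x. f (act s x)) x - avg C f x) * measure lam C =
      (LINT t|lam. indicator D t * f (act t x) - indicator C t * f (act t x))"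
    using orbit_integrable[OF D f, of x] orbit_integrable[OF C(1,2) f, of x] C(3)
    by (simp add: avg_def left_diff_distrib)
  have sd: "sym_diff C D \<in> sets lam" "emeasure lam (sym_diff C D) < \<infinity>"
  proof -
    show *: "sym_diff C D \<in> sets lam" using compact_sets C D by auto
    have "emeasure lam (sym_diff C D) \<le> emeasure lam (C \<union> D)"
      using compact_sets C D by (intro emeasure_mono) auto
    then show "emeasure lam (sym_diff C D) < \<infinity>"
      using compact_emeasure[OF compact_Un[OF C(1) D(1)]] by (rule le_less_trans)
  qed
  have "\<bar>LINT t|lam. indicator D t * f (act t x) - indicator C t * f (act t x)\<bar> \<le>
      (LINT t|lam. \<bar>indicator D t * f (act t x) - indicator C t * f (act t x)\<bar>)"
    by (rule integral_abs_bound)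
  also have "\<dots> \<le> (LINT t|lam. B * indicator (sym_diff C D) t)"
  proof (rule integral_mono)
    show "integrable lam (\<lambda>t. \<bar>indicator D t * f (act t x) - indicator C t * f (act t x)\<bar>)"
      using orbit_integrable[OF D f, of x] orbit_integrable[OF C(1,2) f, of x] by simp
    have "integrable lam (indicat_real (sym_diff C D))"
      using sd by (rule integrable_real_indicator)
    then show "integrable lam (\<lambda>t. B * indicat_real (sym_diff C D) t)" by (rule integrable_mult_right)
    show "\<bar>indicator D t * f (act t x) - indicator C t * f (act t x)\<bar> \<le> B * indicator (sym_diff C D) t" for t
      using B[of "act t x"] by (auto simp: indicator_def)
  qed
  also have "\<dots> = B * measure lam (sym_diff C D)" by (simp add: space_lam)
  finally have "\<bar>avg C (\<lambda>x. f (act s x)) x - avg C f x\<bar> * measure lam C \<le> B * measure lam (sym_diff C D)"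
    unfolding eq[symmetric] using C(3) by (simp add: abs_mult)
  then show ?thesis using C(3) by (simp add: D_def field_simps)
qed

end

section \<open>Centers of attraction\<close>

context haar_action
begin

lemma visit_sets:
  assumes "compact C" "C \<subseteq> H" "open U"
  shows "{s \<in> C. act s x \<in> U} \<in> sets lam"
proof -
  obtain A where "open A" "A \<inter> C = (\<lambda>s. act s x) -` U \<inter> C"
    using continuous_orbit[OF assms(2), of x] assms(3) unfolding continuous_on_open_invariant by blast
  moreover have "{s \<in> C. act s x \<in> U} = (\<lambda>s. act s x) -` U \<inter> C" by auto
  ultimately show ?thesis
    using compact_sets[OF assms(1)] by (metis borel_open sets.Int sets_lam)
qed

lemma visit_integrable:
  assumes "compact C" "C \<subseteq> H" "open U"
  shows "integrable lam (indicator {s \<in> C. act s x \<in> U} :: 'g \<Rightarrow> real)"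
proof (rule integrable_real_indicator[OF visit_sets[OF assms]])
  have "emeasure lam {s \<in> C. act s x \<in> U} \<le> emeasure lam C"
    using compact_sets[OF assms(1)] by (intro emeasure_mono) auto
  then show "emeasure lam {s \<in> C. act s x \<in> U} < \<infinity>"
    using compact_emeasure[OF assms(1)] by (rule le_less_trans)
qed

definition avg_state :: "'g set \<Rightarrow> 'k \<Rightarrow> ('k \<Rightarrow> real) \<Rightarrow> real" where
  "avg_state C x f = (if continuous_on UNIV f then avg C f x else 0)"

lemma state_avg_state:
  assumes C: "compact C" "C \<subseteq> H" "0 < measure lam C"
  shows "state (avg_state C x)"
  unfolding state_def
proof (intro conjI allI impI)
  note int = orbit_integrable[OF C(1,2), of _ x]
  fix f g :: "'k \<Rightarrow> real" and c :: real assume f: "continuous_on UNIV f"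
  show "avg_state C x (\<lambda>x. c * f x) = c * avg_state C x f"
    using f int[OF f] by (simp add: avg_state_def avg_def continuous_on_mult_left mult.left_commute)
  assume g: "continuous_on UNIV g"
  show "avg_state C x (\<lambda>x. f x + g x) = avg_state C x f + avg_state C x g"
    using f g int[OF f] int[OF g]
    by (simp add: avg_state_def avg_def continuous_on_add distrib_left add_divide_distrib)
next
  fix f :: "'k \<Rightarrow> real" assume "continuous_on UNIV f" "\<forall>x. 0 \<le> f x"
  then show "0 \<le> avg_state C x f"
    by (auto simp: avg_state_def avg_def intro!: divide_nonneg_nonneg integral_nonneg)
next
  show "avg_state C x (\<lambda>x. 1) = 1"
    using C by (simp add: avg_state_def avg_def space_lam)
qed (simp add: avg_state_def)

lemma folner_set:
  assumes "folner_sequence lam H F"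
  shows "compact (F n)" "F n \<subseteq> H" "0 < measure lam (F n)"
  using assms by (auto simp: folner_sequence_def)

text \<open>The reindexing \<open>r\<close> lets the cluster state remember a lower bound that holds
  only along selected indices. The Folner property persists along \<open>r\<close>, which makes the
  limit invariant although the single averages are not.\<close>

lemma cluster_state_exists:
  assumes F: "folner_sequence lam H F" and r: "filterlim r sequentially sequentially"
  obtains \<phi> where "\<phi> \<in> invariant_states (act ` H)"
    "\<And>f c. continuous_on UNIV f \<Longrightarrow> (\<And>n. c \<le> avg (F (r n)) f x) \<Longrightarrow> c \<le> \<phi> f"
proof -
  note C = folner_set[OF F]
  define \<psi> where "\<psi> n = avg_state (F (r n)) x" for n :: nat
  have st: "\<psi> n \<in> invariant_states {}" for n
    using state_avg_state[OF C] by (simp add: invariant_states_def \<psi>_def)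
  have "\<exists>\<phi>\<in>invariant_states {}. inf (nhds \<phi>) (filtermap \<psi> sequentially) \<noteq> bot"
    using compact_invariant_states[OF K, of "{}"] st unfolding compact_filter
    by (auto simp: filtermap_bot_iff eventually_filtermap)
  then obtain \<phi> where \<phi>: "\<phi> \<in> invariant_states {}" "inf (nhds \<phi>) (filtermap \<psi> sequentially) \<noteq> bot"
    by blast
  \<comment> \<open>A proper filter that converges to \<open>\<phi>\<close> and refines the image of
    the sequence: limits of evaluations and limits along the sequence both hold along
    \<open>G\<close>, hence agree.\<close>
  define G where "G = inf (nhds \<phi>) (filtermap \<psi> sequentially)"
  have Gnt: "G \<noteq> bot" using \<phi> by (simp add: G_def)
  have lim: "((\<lambda>\<eta>. \<eta> f) \<longlongrightarrow> \<phi> f) G" for f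
  proof -
    have "continuous_on UNIV (\<lambda>\<eta> :: ('k \<Rightarrow> real) \<Rightarrow> real. \<eta> f)"
      by (rule continuous_on_product_coordinates)
    then have "open ((\<lambda>\<eta> :: ('k \<Rightarrow> real) \<Rightarrow> real. \<eta> f) -` S)" if "open S" for S
      using that by (intro open_vimage)
    then have "((\<lambda>\<eta>. \<eta> f) \<longlongrightarrow> \<phi> f) (nhds \<phi>)"
      by (intro topological_tendstoI) (force simp: eventually_nhds)
    then show ?thesis by (rule tendsto_mono[rotated]) (simp add: G_def)
  qed
  have "\<phi> (\<lambda>x. f (act s x)) = \<phi> f" if s: "s \<in> H" and f: "continuous_on UNIV f" for s f
  proof -
    obtain B where B: "\<And>x. \<bar>f x\<bar> \<le> B" using compact_continuous_bounded[OF K f] by metis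
    have "(\<lambda>n. B * (measure lam (sym_diff (F n) ((+) s ` F n)) / measure lam (F n))) \<longlonglongrightarrow> B * 0"
      using F s by (intro tendsto_mult tendsto_const) (auto simp: folner_sequence_def)
    then have lim0: "(\<lambda>n. B * (measure lam (sym_diff (F (r n)) ((+) s ` F (r n))) / measure lam (F (r n)))) \<longlonglongrightarrow> 0"
      using filterlim_compose[OF _ r] by fastforce
    have "(\<lambda>n. \<psi> n (\<lambda>x. f (act s x)) - \<psi> n f) \<longlonglongrightarrow> 0"
    proof (rule Lim_null_comparison[OF _ lim0], rule always_eventually, rule allI)
      fix n
      show "norm (\<psi> n (\<lambda>x. f (act s x)) - \<psi> n f) \<le>
          B * (measure lam (sym_diff (F (r n)) ((+) s ` F (r n))) / measure lam (F (r n)))"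
        using avg_translate_le[OF C f s B] f continuous_koopman[OF s f] by (simp add: \<psi>_def avg_state_def)
    qed
    then have "((\<lambda>\<eta>. \<eta> (\<lambda>x. f (act s x)) - \<eta> f) \<longlongrightarrow> 0) (filtermap \<psi> sequentially)"
      by (simp add: filterlim_filtermap)
    then have "((\<lambda>\<eta>. \<eta> (\<lambda>x. f (act s x)) - \<eta> f) \<longlongrightarrow> 0) G"
      by (rule tendsto_mono[rotated]) (simp add: G_def)
    moreover have "((\<lambda>\<eta>. \<eta> (\<lambda>x. f (act s x)) - \<eta> f) \<longlongrightarrow> \<phi> (\<lambda>x. f (act s x)) - \<phi> f) G"
      by (intro tendsto_diff lim)
    ultimately show ?thesis using tendsto_unique[OF Gnt] by fastforce
  qed
  then have "\<phi> \<in> invariant_states (act ` H)" using \<phi> by (simp add: invariant_states_def)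
  moreover have "c \<le> \<phi> f" if f: "continuous_on UNIV f" and c: "\<And>n. c \<le> avg (F (r n)) f x" for f c
  proof (rule tendsto_lowerbound[OF lim _ Gnt])
    have "eventually (\<lambda>\<eta>. c \<le> \<eta> f) (filtermap \<psi> sequentially)"
      using f c by (simp add: eventually_filtermap \<psi>_def avg_state_def)
    then show "eventually (\<lambda>\<eta>. c \<le> \<eta> f) G"
      by (rule filter_leD[rotated]) (simp add: G_def)
  qed
  ultimately show thesis by (rule that)
qed

text \<open>On the time spent in \<open>U\<close> the orbit average collects at most
  \<open>a\<close>, on the remaining fraction of \<open>C\<close> at most
  \<open>a + b\<close>.\<close>

lemma avg_le_visit:
  assumes C: "compact C" "C \<subseteq> H" "0 < measure lam C" and f: "continuous_on UNIV f"
    and U: "open U" and le: "\<And>x. x \<in> U \<Longrightarrow> f x \<le> a" "\<And>x. f x \<le> a + b"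
  shows "avg C f x \<le> a + b * (1 - measure lam {s \<in> C. act s x \<in> U} / measure lam C)"
proof -
  let ?V = "{s \<in> C. act s x \<in> U}"
  have "(LINT s|lam. indicator C s * f (act s x)) \<le>
      (LINT s|lam. a * indicator C s + b * (indicator C s - indicator ?V s))"
    using visit_integrable[OF C(1,2) U, of x] indicator_integrable[OF C(1)] orbit_integrable[OF C(1,2) f, of x]
  proof (intro integral_mono Bochner_Integration.integrable_add integrable_mult_right
      Bochner_Integration.integrable_diff)
    show "indicator C s * f (act s x) \<le> a * indicator C s + b * (indicator C s - indicator ?V s)" for s
      using le by (simp add: indicator_def)
  qed auto
  also have "\<dots> = a * measure lam C + b * (measure lam C - measure lam ?V)"
    using visit_integrable[OF C(1,2) U, of x] indicator_integrable[OF C(1)] by (simp add: space_lam)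
  finally show ?thesis using C(3) by (simp add: avg_def field_simps)
qed

lemma avg_ge_visit:
  assumes C: "compact C" "C \<subseteq> H" "0 < measure lam C" and f: "continuous_on UNIV f"
    and U: "open U" and ge: "\<And>x. x \<notin> U \<Longrightarrow> 1 \<le> f x" "\<And>x. 0 \<le> f x"
  shows "1 - measure lam {s \<in> C. act s x \<in> U} / measure lam C \<le> avg C f x"
proof -
  let ?V = "{s \<in> C. act s x \<in> U}"
  have "(LINT s|lam. indicator C s - indicator ?V s) \<le> (LINT s|lam. indicator C s * f (act s x))"
    using visit_integrable[OF C(1,2) U, of x] indicator_integrable[OF C(1)] orbit_integrable[OF C(1,2) f, of x]
  proof (intro integral_mono Bochner_Integration.integrable_diff)
    show "indicator C s - indicator ?V s \<le> indicator C s * f (act s x)" for s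
      using ge by (simp add: indicator_def)
  qed auto
  moreover have "(LINT s|lam. indicator C s - indicator ?V s) = measure lam C - measure lam ?V"
    using visit_integrable[OF C(1,2) U, of x] indicator_integrable[OF C(1)] by (simp add: space_lam)
  ultimately have "(measure lam C - measure lam ?V) / measure lam C \<le> avg C f x"
    unfolding avg_def using C(3) by (intro divide_right_mono) auto
  then show ?thesis using C(3) by (simp add: diff_divide_distrib)
qed

lemma visit_ratio_le_1:
  assumes C: "compact C" "C \<subseteq> H" "0 < measure lam C" and U: "open U"
  shows "measure lam {s \<in> C. act s x \<in> U} / measure lam C \<le> 1"
proof -
  have "measure lam {s \<in> C. act s x \<in> U} \<le> measure lam C"
    using compact_emeasure[OF C(1)] compact_sets[OF C(1)] visit_sets[OF C(1,2) U]
    by (intro measure_mono_fmeasurable) (auto simp: fmeasurable_def)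
  then show ?thesis using C(3) by simp
qed

definition states_vanish_off :: "'k set \<Rightarrow> bool" where
  "states_vanish_off L \<longleftrightarrow> (\<forall>\<phi>\<in>invariant_states (act ` H). \<forall>f. continuous_on UNIV f \<longrightarrow>
     (\<forall>x. 0 \<le> f x) \<longrightarrow> (\<forall>x\<in>L. f x = 0) \<longrightarrow> \<phi> f = 0)"

lemma center_imp_states_vanish:
  assumes F: "folner_sequence lam H F" and L: "center_of_attraction lam F act L"
  shows "states_vanish_off L"
  unfolding states_vanish_off_def
proof (intro ballI allI impI)
  note C = folner_set[OF F]
  fix \<phi> and f :: "'k \<Rightarrow> real"
  assume \<phi>: "\<phi> \<in> invariant_states (act ` H)" and f: "continuous_on UNIV f"
    and pos: "\<forall>x. 0 \<le> f x" and fL: "\<forall>x\<in>L. f x = 0"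
  interpret \<phi>: state_on_compact \<phi>
    using K \<phi> by unfold_locales (auto simp: invariant_states_def)
  interpret prob_space \<phi>.radon by (rule \<phi>.prob_space_radon)
  obtain B where B: "0 < B" "\<And>x. \<bar>f x\<bar> \<le> B" using compact_continuous_bounded[OF K f] by metis
  have avg_nonneg: "0 \<le> avg (F n) f x" for n x
    using pos by (auto simp: avg_def intro!: divide_nonneg_nonneg integral_nonneg)
  \<comment> \<open>The visiting bound for \<open>U = UNIV\<close> and \<open>b = 0\<close>; it
    supplies the majorant for dominated convergence.\<close>
  have avg_le: "avg (F n) f x \<le> B" for n x
    using avg_le_visit[OF C f, of UNIV B 0] B(2) by (auto simp: abs_le_iff)
  have lim: "(\<lambda>n. avg (F n) f x) \<longlonglongrightarrow> 0" for x
  proof (rule LIMSEQ_I)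
    fix e :: real assume e: "0 < e"
    \<comment> \<open>An open neighborhood of \<open>L\<close>, since \<open>f\<close> vanishes
      there. Visits to it contribute at most \<open>e / 2\<close>, and the time outside becomes
      negligible because \<open>L\<close> is a center.\<close>
    define U where "U = {x. f x < e / 2}"
    have U: "open U" unfolding U_def using f by (intro open_Collect_less continuous_on_const)
    have LU: "L \<subseteq> U" using fL e by (auto simp: U_def)
    let ?p = "\<lambda>n. measure lam {s \<in> F n. act s x \<in> U} / measure lam (F n)"
    have "?p \<longlonglongrightarrow> 1" using L U LU by (auto simp: center_of_attraction_def)
    then have "(\<lambda>n. e / 2 + B * (1 - ?p n)) \<longlonglongrightarrow> e / 2 + B * (1 - 1)"
      by (intro tendsto_intros)
    then have "eventually (\<lambda>n. e / 2 + B * (1 - ?p n) < e) sequentially"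
      by (rule order_tendstoD) (use e in simp)
    moreover have "avg (F n) f x \<le> e / 2 + B * (1 - ?p n)" for n
    proof (rule avg_le_visit[OF C f U])
      show "f y \<le> e / 2 + B" for y using B(2)[of y] e by (simp add: abs_le_iff)
    qed (simp add: U_def)
    ultimately have "eventually (\<lambda>n. avg (F n) f x < e) sequentially"
      by (auto elim!: eventually_mono intro: le_less_trans)
    then show "\<exists>no. \<forall>n\<ge>no. norm (avg (F n) f x - 0) < e"
      using avg_nonneg by (auto simp: eventually_sequentially)
  qed
  have inv: "(LINT x|\<phi>.radon. f (act s x)) = (LINT x|\<phi>.radon. f x)" if "s \<in> H" for s
    using \<phi> that f \<phi>.integral_radon continuous_koopman[OF that f] by (auto simp: invariant_states_def)
  \<comment> \<open>These integrals tend to 0, yet by \<open>integral_avg\<close> all of them equal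
    the integral of \<open>f\<close>.\<close>
  have "(\<lambda>n. LINT x|\<phi>.radon. avg (F n) f x) \<longlonglongrightarrow> (LINT x|\<phi>.radon. (0::real))"
  proof (rule integral_dominated_convergence[where w = "\<lambda>_. B"])
    show "(avg (F n) f) \<in> borel_measurable \<phi>.radon" for n
      using borel_measurable_continuous_onI[OF continuous_avg[OF C f]]
      by (simp add: \<phi>.sets_radon cong: measurable_cong_sets)
  qed (use lim avg_nonneg avg_le in auto)
  then have "(\<lambda>n. LINT x|\<phi>.radon. f x) \<longlonglongrightarrow> 0"
    using integral_avg[OF C f \<phi>.prob_space_radon \<phi>.sets_radon inv] by simp
  then show "\<phi> f = 0" using \<phi>.integral_radon[OF f] by (simp add: LIMSEQ_const_iff)
qed

lemma states_vanish_imp_center: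
  assumes F: "folner_sequence lam H F" and L: "closed L" "L \<noteq> {}" and van: "states_vanish_off L"
  shows "center_of_attraction lam F act L"
  unfolding center_of_attraction_def
proof (intro conjI L allI impI, elim conjE, rule ccontr)
  note C = folner_set[OF F]
  fix U x
  let ?p = "\<lambda>n. measure lam {s \<in> F n. act s x \<in> U} / measure lam (F n)"
  assume U: "open U" "L \<subseteq> U" and "\<not> ?p \<longlonglongrightarrow> 1"
  then obtain e where e: "0 < e" "\<forall>N. \<exists>n\<ge>N. e \<le> dist (?p n) 1"
    by (auto simp: LIMSEQ_def not_less)
  \<comment> \<open>Indices at which the visiting frequency stays at least \<open>e\<close> away
    from 1. They may repeat; \<open>N \<le> r N\<close> is enough to send them to infinity.\<close>
  then obtain r where r: "\<And>N. N \<le> r N" "\<And>N. e \<le> dist (?p (r N)) 1" by metis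
  have "filterlim r sequentially sequentially"
    by (rule filterlim_at_top_mono[OF filterlim_ident]) (use r in simp)
  then obtain \<phi> where \<phi>: "\<phi> \<in> invariant_states (act ` H)"
    "\<And>f c. continuous_on UNIV f \<Longrightarrow> (\<And>n. c \<le> avg (F (r n)) f x) \<Longrightarrow> c \<le> \<phi> f"
    using cluster_state_exists[OF F] by metis
  obtain h :: "'k \<Rightarrow> real" where h: "continuous_on UNIV h" "\<And>x. 0 \<le> h x" "\<And>x. h x \<le> 1"
    "\<And>x. x \<in> L \<Longrightarrow> h x = 0" "\<And>x. x \<in> -U \<Longrightarrow> h x = 1"
    using compact_t2_Urysohn[OF K L(1), of "-U"] U by auto
  have "e \<le> avg (F (r n)) h x" for n
  proof -
    \<comment> \<open>A frequency is at most 1, so distance \<open>e\<close> from 1 means a deficit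
      of at least \<open>e\<close>.\<close>
    have "e \<le> 1 - ?p (r n)"
      using r(2)[of n] visit_ratio_le_1[OF C U(1), of "r n" x] by (simp add: dist_real_def)
    also have "\<dots> \<le> avg (F (r n)) h x"
      using h by (intro avg_ge_visit[OF C h(1) U(1)]) auto
    finally show ?thesis .
  qed
  then have "e \<le> \<phi> h" using \<phi>(2)[OF h(1)] by blast
  moreover have "\<phi> h = 0" using van \<phi>(1) h by (auto simp: states_vanish_off_def)
  ultimately show False using e by simp
qed

end

section \<open>Supports of regular measures and ideals of continuous functions\<close>

lemma measure_support_props:
  fixes \<mu> :: "'k::t2_space measure"
  assumes \<mu>: "regular_probability_measure \<mu>"
  shows "closed (measure_support \<mu>)" "emeasure \<mu> (measure_support \<mu>) = 1"
    "\<And>A. closed A \<Longrightarrow> emeasure \<mu> A = 1 \<Longrightarrow> measure_support \<mu> \<subseteq> A"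
proof -
  interpret prob_space \<mu> using \<mu> by (rule regular_prob_space)
  note sets = regular_sets[OF \<mu>] and space = regular_space[OF \<mu>]
  define \<A> where "\<A> = {A. closed A \<and> emeasure \<mu> A = 1}"
  have T: "closed (\<Inter>\<A>)" by (auto simp: \<A>_def)
  have null: "- A \<in> null_sets \<mu>" if "A \<in> \<A>" for A
  proof -
    have "A \<in> events" "prob A = 1" using that by (auto simp: \<A>_def sets emeasure_eq_measure)
    then have "prob (space \<mu> - A) = 0" using prob_compl[of A] by simp
    then show ?thesis
      using \<open>A \<in> events\<close> sets.compl_sets[of A \<mu>]
      by (auto simp: null_sets_def space Compl_eq_Diff_UNIV emeasure_eq_measure)
  qed
  \<comment> \<open>The closed sets of full measure may form an uncountable family, so countable
    additivity does not control their intersection. Inner regularity does: a compact subset of the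
    complement is covered by finitely many null sets.\<close>
  have "prob (- \<Inter>\<A>) \<le> 0"
  proof (rule field_le_epsilon)
    fix e :: real assume "0 < e"
    have "- \<Inter>\<A> \<in> sets borel" using T by auto
    then obtain C where C: "compact C" "C \<subseteq> - \<Inter>\<A>" "prob (- \<Inter>\<A>) - e < prob C"
      using regular_inner[OF \<mu> _ \<open>0 < e\<close>] by blast
    obtain \<B> where \<B>: "\<B> \<subseteq> \<A>" "finite \<B>" "C \<subseteq> (\<Union>A\<in>\<B>. - A)"
    proof (rule compactE_image[OF C(1), of \<A> uminus])
      show "C \<subseteq> (\<Union>A\<in>\<A>. - A)" using C(2) by auto
    qed (auto simp: \<A>_def)
    have "(\<Union>A\<in>\<B>. - A) \<in> null_sets \<mu>" using \<B> null by (intro null_sets.finite_UN) auto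
    then have "prob C = 0"
      using null_sets_subset[of _ \<mu> C] \<B>(3) compact_imp_closed[OF C(1)]
      by (auto simp: sets measure_eq_0_null_sets)
    then show "prob (- \<Inter>\<A>) \<le> 0 + e" using C by simp
  qed
  then have "prob (\<Inter>\<A>) = 1"
    using prob_compl[of "\<Inter>\<A>"] T measure_nonneg[of \<mu> "- \<Inter>\<A>"]
      borel_closed[OF T]
    unfolding space sets Compl_eq_Diff_UNIV[of "\<Inter>\<A>"] by linarith
  then have "\<Inter>\<A> \<in> \<A>" using T by (simp add: \<A>_def emeasure_eq_measure)
  then have eq: "measure_support \<mu> = \<Inter>\<A>"
    unfolding measure_support_def by (intro Least_equality) (auto simp: \<A>_def)
  show "closed (measure_support \<mu>)" "emeasure \<mu> (measure_support \<mu>) = 1"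
    "\<And>A. closed A \<Longrightarrow> emeasure \<mu> A = 1 \<Longrightarrow> measure_support \<mu> \<subseteq> A"
    using \<open>\<Inter>\<A> \<in> \<A>\<close> unfolding eq by (auto simp: \<A>_def)
qed

text \<open>The zero set of \<open>f\<close> is closed, and a closed set has full measure exactly
  when it contains the support.\<close>

lemma integral_zero_iff_support:
  fixes \<mu> :: "'k::t2_space measure" and f :: "'k \<Rightarrow> real"
  assumes K: "compact (UNIV :: 'k set)" and \<mu>: "regular_probability_measure \<mu>"
    and f: "continuous_on UNIV f" "\<And>x. 0 \<le> f x"
  shows "(LINT x|\<mu>. f x) = 0 \<longleftrightarrow> (\<forall>x\<in>measure_support \<mu>. f x = 0)"
proof -
  interpret prob_space \<mu> using \<mu> by (rule regular_prob_space)
  note sets = regular_sets[OF \<mu>] and space = regular_space[OF \<mu>]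
  note supp = measure_support_props[OF \<mu>]
  have Z: "closed {x. f x = 0}" using f by (intro closed_Collect_eq continuous_on_const)
  have AE_supp: "AE x in \<mu>. x \<in> measure_support \<mu>"
    using supp(1,2) by (subst prob_eq_1[symmetric]) (auto simp: sets emeasure_eq_measure)
  have "integrable \<mu> f" using continuous_integrable[OF K prob_space_axioms sets f(1)] .
  then have "(LINT x|\<mu>. f x) = 0 \<longleftrightarrow> (AE x in \<mu>. f x = 0)"
    using f by (intro integral_nonneg_eq_0_iff_AE) auto
  also have "\<dots> \<longleftrightarrow> (AE x in \<mu>. x \<in> {x. f x = 0})" by simp
  also have "\<dots> \<longleftrightarrow> prob {x. f x = 0} = 1" using Z by (intro prob_eq_1[symmetric]) (auto simp: sets)
  also have "\<dots> \<longleftrightarrow> measure_support \<mu> \<subseteq> {x. f x = 0}"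
  proof
    assume "prob {x. f x = 0} = 1"
    then show "measure_support \<mu> \<subseteq> {x. f x = 0}"
      using supp(3)[OF Z] by (simp add: emeasure_eq_measure)
  next
    assume "measure_support \<mu> \<subseteq> {x. f x = 0}"
    then have "AE x in \<mu>. x \<in> {x. f x = 0}" using AE_supp by (auto elim: eventually_mono)
    then show "prob {x. f x = 0} = 1" using Z by (subst prob_eq_1) (auto simp: sets)
  qed
  finally show ?thesis by auto
qed

lemma measure_ideal_eq:
  fixes \<mu> :: "'k::t2_space measure"
  assumes K: "compact (UNIV :: 'k set)" and \<mu>: "regular_probability_measure \<mu>"
  shows "measure_ideal \<mu> = vanishing_ideal (measure_support \<mu>)"
proof -
  have "(LINT x|\<mu>. cmod (apply_bcontfun f x)) = 0 \<longleftrightarrow> (\<forall>x\<in>measure_support \<mu>. cmod (apply_bcontfun f x) = 0)"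
    for f :: "'k \<Rightarrow>\<^sub>C complex"
    by (rule integral_zero_iff_support[OF K \<mu>]) (auto intro: continuous_intros)
  then show ?thesis by (auto simp: measure_ideal_def vanishing_ideal_def)
qed

text \<open>Urysohn functions separate points from closed sets, so a closed set can be recovered
  from its ideal. This is also the uniqueness behind \<open>THE\<close> in
  \<open>ideal_support\<close>.\<close>

lemma vanishing_ideal_subset_iff:
  fixes L M :: "'k::t2_space set"
  assumes K: "compact (UNIV :: 'k set)" and L: "closed L"
  shows "vanishing_ideal L \<subseteq> vanishing_ideal M \<longleftrightarrow> M \<subseteq> L"
proof
  assume sub: "vanishing_ideal L \<subseteq> vanishing_ideal M"
  show "M \<subseteq> L"
  proof (rule ccontr)
    assume "\<not> M \<subseteq> L"
    then obtain x where x: "x \<in> M" "x \<notin> L" by blast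
    obtain h :: "'k \<Rightarrow> real" where h: "continuous_on UNIV h"
      "\<And>x. x \<in> L \<Longrightarrow> h x = 0" "\<And>y. y \<in> {x} \<Longrightarrow> h y = 1"
      using compact_t2_Urysohn[OF K L closed_singleton[of x]] x(2) by (metis Int_insert_right_if0 Int_empty_right)
    have eq: "apply_bcontfun (Bcontfun (\<lambda>x. complex_of_real (h x))) = (\<lambda>x. complex_of_real (h x))"
      using h by (intro apply_bcontfun_Bcontfun[OF K] continuous_intros)
    then have "Bcontfun (\<lambda>x. complex_of_real (h x)) \<in> vanishing_ideal L"
      using h by (simp add: vanishing_ideal_def)
    then have "Bcontfun (\<lambda>x. complex_of_real (h x)) \<in> vanishing_ideal M" using sub by blast
    then show False using x(1) h(3) by (auto simp: vanishing_ideal_def eq)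
  qed
qed (auto simp: vanishing_ideal_def)

lemma ideal_support_vanishing_ideal:
  fixes L :: "'k::t2_space set"
  assumes K: "compact (UNIV :: 'k set)" and L: "closed L"
  shows "ideal_support (vanishing_ideal L) = L"
  unfolding ideal_support_def
proof (rule the_equality)
  fix M assume "closed M \<and> vanishing_ideal L = vanishing_ideal M"
  then show "M = L"
    using vanishing_ideal_subset_iff[OF K, of L M] vanishing_ideal_subset_iff[OF K, of M L] L by auto
qed (use L in simp)

lemma Inter_vanishing_ideal:
  "(\<Inter>i\<in>I. vanishing_ideal (A i)) = vanishing_ideal (closure (\<Union>i\<in>I. A i))"
proof -
  have "(\<Union>i\<in>I. A i) \<subseteq> {x. apply_bcontfun f x = 0} \<longleftrightarrow> closure (\<Union>i\<in>I. A i) \<subseteq> {x. apply_bcontfun f x = 0}"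
    for f :: "'a \<Rightarrow>\<^sub>C complex"
  proof -
    have "closed {x. apply_bcontfun f x = 0}" by (intro closed_Collect_eq) auto
    then show ?thesis by (meson closure_minimal closure_subset order_trans)
  qed
  then have "f \<in> (\<Inter>i\<in>I. vanishing_ideal (A i)) \<longleftrightarrow> f \<in> vanishing_ideal (closure (\<Union>i\<in>I. A i))" for f
    by (simp add: vanishing_ideal_def subset_eq)
  then show ?thesis by blast
qed

section \<open>Ergodic measures and the smallest center\<close>

context haar_action
begin

abbreviation koopmans :: "'k operator set" where
  "koopmans \<equiv> koopman_semigroup H act"

lemma ergodicD:
  assumes "\<mu> \<in> ergodic_measures koopmans"
  shows "regular_probability_measure \<mu>" "\<And>s. s \<in> H \<Longrightarrow> distr \<mu> borel (act s) = \<mu>"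
proof -
  have *: "regular_probability_measure \<mu>"
    "\<And>s g. s \<in> H \<Longrightarrow> continuous_on UNIV (g :: 'k \<Rightarrow> real) \<Longrightarrow> (LINT x|\<mu>. g (act s x)) = (LINT x|\<mu>. g x)"
    using assms invariant_measures_koopman_iff[where H = H and act = act and \<mu> = \<mu>, OF K continuous_act]
    by (auto simp: ergodic_measures_def)
  show "regular_probability_measure \<mu>" by (rule *)
  show "distr \<mu> borel (act s) = \<mu>" if "s \<in> H" for s
    using distr_eq_of_invariant[OF K *(1) continuous_act[OF that]] *(2)[OF that] by blast
qed

lemma ergodic_integral_invariant_state:
  assumes \<mu>: "\<mu> \<in> ergodic_measures koopmans"
  obtains \<phi> where "\<phi> \<in> invariant_states (act ` H)"
    "\<And>f. continuous_on UNIV f \<Longrightarrow> (LINT x|\<mu>. f x) = \<phi> f"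
proof
  note reg = ergodicD[OF \<mu>]
  interpret prob_space \<mu> using reg(1) by (rule regular_prob_space)
  have p: "prob UNIV = 1" using prob_space regular_space[OF reg(1)] by simp
  \<comment> \<open>Conditioning on the whole space is plain integration, normalized to 0 at
    discontinuous functions as \<open>state\<close> requires.\<close>
  show "conditional_state \<mu> UNIV \<in> invariant_states (act ` H)"
    using reg continuous_act p by (intro conditional_state_invariant[OF K]) auto
  show "(LINT x|\<mu>. f x) = conditional_state \<mu> UNIV f" if "continuous_on UNIV f" for f
    using that p by (simp add: conditional_state_def)
qed

text \<open>By \<open>L1_extension_AE\<close> a fixed vector is invariant under each
  \<open>act s\<close> up to a null set that may depend on \<open>s\<close>, and this is the form of
  invariance that the zero-one law accepts. Real and imaginary parts are therefore constant, and the
  constant 1 spans the fixed space.\<close>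

lemma ergodic_of_extreme:
  assumes \<phi>: "extreme_in (invariant_states (act ` H)) \<phi>"
  obtains \<mu> where "\<mu> \<in> ergodic_measures koopmans"
    "\<And>f. continuous_on UNIV f \<Longrightarrow> (LINT x|\<mu>. f x) = \<phi> f"
proof -
  have \<phi>_inv: "\<phi> \<in> invariant_states (act ` H)" using \<phi> by (simp add: extreme_in_def)
  interpret \<phi>: state_on_compact \<phi>
    using K \<phi>_inv by unfold_locales (auto simp: invariant_states_def)
  define \<mu> where "\<mu> = \<phi>.radon"
  have reg: "regular_probability_measure \<mu>" and rep: "\<And>f. continuous_on UNIV f \<Longrightarrow> (LINT x|\<mu>. f x) = \<phi> f"
    using \<phi>.regular_radon \<phi>.integral_radon by (auto simp: \<mu>_def)
  interpret prob_space \<mu> using reg by (rule regular_prob_space)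
  have inv: "(LINT x|\<mu>. g (act s x)) = (LINT x|\<mu>. g x)" if "s \<in> H" "continuous_on UNIV g"
    for s and g :: "'k \<Rightarrow> real"
    using \<phi>_inv that rep[OF that(2)] rep[OF continuous_koopman[OF that]] by (simp add: invariant_states_def)
  then have \<mu>_inv: "\<mu> \<in> invariant_measures koopmans"
    using invariant_measures_koopman_iff[where H = H and act = act and \<mu> = \<mu>, OF K continuous_act] reg by blast
  have distr: "distr \<mu> borel (act s) = \<mu>" if "s \<in> H" for s
    using distr_eq_of_invariant[OF K reg continuous_act[OF that]] inv[OF that] by blast
  have ext: "AE x in \<mu>. L1_extension \<mu> (koopman act s) f x = f (act s x)"
    if "s \<in> H" "integrable \<mu> f" for s f
    using that koopman_apply[where act = act, OF K continuous_act[OF that(1)]]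
    by (intro L1_extension_AE[OF K reg continuous_act distr]) auto
  have one: "(\<lambda>_. 1) \<in> L1_fixed_space koopmans \<mu>"
    using ext[of _ "\<lambda>_. 1"] by (auto simp: L1_fixed_space_def koopman_semigroup_def)
  have const: "\<exists>c. AE x in \<mu>. f x = c * 1" if f: "f \<in> L1_fixed_space koopmans \<mu>" for f
  proof -
    have fi: "integrable \<mu> f" using f by (simp add: L1_fixed_space_def)
    have fixed: "AE x in \<mu>. f (\<sigma> x) = f x" if \<sigma>: "\<sigma> \<in> act ` H" for \<sigma>
    proof -
      obtain s where s: "s \<in> H" "\<sigma> = act s" using \<sigma> by auto
      have "AE x in \<mu>. L1_extension \<mu> (koopman act s) f x = f x"
        using f s by (auto simp: L1_fixed_space_def koopman_semigroup_def)
      with ext[OF s(1) fi] show ?thesis unfolding s by eventually_elim simp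
    qed
    have \<Sigma>: "continuous_on UNIV \<sigma>" "distr \<mu> borel \<sigma> = \<mu>" if "\<sigma> \<in> act ` H" for \<sigma>
      using that continuous_act distr by auto
    note const = extreme_state_invariant_constant[OF K reg \<Sigma> \<phi> rep]
    have "AE x in \<mu>. Re (f x) = (LINT x|\<mu>. Re (f x))"
    proof (rule const)
      show "AE x in \<mu>. Re (f (\<sigma> x)) = Re (f x)" if "\<sigma> \<in> act ` H" for \<sigma>
        using fixed[OF that] by eventually_elim simp
    qed (use fi in auto)
    moreover have "AE x in \<mu>. Im (f x) = (LINT x|\<mu>. Im (f x))"
    proof (rule const)
      show "AE x in \<mu>. Im (f (\<sigma> x)) = Im (f x)" if "\<sigma> \<in> act ` H" for \<sigma>
        using fixed[OF that] by eventually_elim simp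
    qed (use fi in auto)
    ultimately have "AE x in \<mu>. f x = Complex (LINT x|\<mu>. Re (f x)) (LINT x|\<mu>. Im (f x)) * 1"
      by eventually_elim (simp add: complex_eq_iff)
    then show ?thesis by blast
  qed
  have "\<mu> \<in> ergodic_measures koopmans"
    unfolding ergodic_measures_def mem_Collect_eq
  proof (intro conjI \<mu>_inv bexI[OF _ one] ballI)
    show "\<not> (AE x in \<mu>. (1::complex) = 0)" by simp
  qed (rule const)
  then show thesis using rep by (rule that)
qed

text \<open>The coordinates of a state are its values at functions, so maximizing the value at
  \<open>f\<close> is minimizing the coordinate \<open>\<lambda>x. - f x\<close>, and an extreme
  minimizer is represented by an ergodic measure.\<close>

lemma ergodic_dominates:
  assumes \<phi>: "\<phi> \<in> invariant_states (act ` H)" and f: "continuous_on UNIV f"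
  obtains \<mu> where "\<mu> \<in> ergodic_measures koopmans" "\<phi> f \<le> (LINT x|\<mu>. f x)"
proof -
  let ?X = "invariant_states (act ` H)" and ?g = "\<lambda>x. - f x"
  have neg: "\<eta> ?g = - \<eta> f" if "\<eta> \<in> ?X" for \<eta>
  proof -
    interpret state_on_compact \<eta>
      using K that by unfold_locales (auto simp: invariant_states_def)
    show ?thesis using scale[OF f, of "-1"] by simp
  qed
  have "?X \<noteq> {}" using \<phi> by blast
  then obtain e where ext: "extreme_in ?X e" and le: "\<And>y. y \<in> ?X \<Longrightarrow> e ?g \<le> y ?g"
    using extreme_minimizer_exists[OF compact_invariant_states[OF K] closed_invariant_states] by metis
  have e: "e \<in> ?X" using ext by (simp add: extreme_in_def)
  obtain \<mu> where \<mu>: "\<mu> \<in> ergodic_measures koopmans"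
    "\<And>f. continuous_on UNIV f \<Longrightarrow> (LINT x|\<mu>. f x) = e f"
    using ergodic_of_extreme[OF ext] by blast
  have "\<phi> f \<le> e f" using le[OF \<phi>] neg[OF \<phi>] neg[OF e] by simp
  then show thesis using that[OF \<mu>(1)] \<mu>(2)[OF f] by simp
qed

definition ergodic_support :: "'k set" where
  "ergodic_support = closure (\<Union>\<mu>\<in>ergodic_measures koopmans. measure_support \<mu>)"

text \<open>A point of an ergodic support outside \<open>L\<close> would be detected by a Urysohn
  function that is 0 on \<open>L\<close> and 1 at the point. Conversely,
  \<open>0 \<le> \<phi> f \<le> (LINT x|\<mu>. f x) = 0\<close> for an ergodic \<open>\<mu>\<close>
  that dominates \<open>\<phi>\<close> at \<open>f\<close>.\<close>

lemma states_vanish_iff: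
  assumes L: "closed L"
  shows "states_vanish_off L \<longleftrightarrow> ergodic_support \<subseteq> L"
proof
  assume van: "states_vanish_off L"
  have "measure_support \<mu> \<subseteq> L" if \<mu>: "\<mu> \<in> ergodic_measures koopmans" for \<mu>
  proof
    fix x assume x: "x \<in> measure_support \<mu>"
    note reg = ergodicD(1)[OF \<mu>]
    obtain \<phi> where \<phi>: "\<phi> \<in> invariant_states (act ` H)"
      "\<And>f. continuous_on UNIV f \<Longrightarrow> (LINT x|\<mu>. f x) = \<phi> f"
      using ergodic_integral_invariant_state[OF \<mu>] by blast
    show "x \<in> L"
    proof (rule ccontr)
      assume "x \<notin> L"
      then obtain h :: "'k \<Rightarrow> real" where h: "continuous_on UNIV h" "\<And>x. 0 \<le> h x"
        "\<And>x. x \<in> L \<Longrightarrow> h x = 0" "\<And>y. y \<in> {x} \<Longrightarrow> h y = 1"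
        using compact_t2_Urysohn[OF K L closed_singleton[of x]]
        by (metis Int_insert_right_if0 Int_empty_right)
      have "(LINT x|\<mu>. h x) = 0" using van \<phi> h by (auto simp: states_vanish_off_def)
      then have "h x = 0" using integral_zero_iff_support[OF K reg h(1,2)] x by blast
      then show False using h(4) by simp
    qed
  qed
  then show "ergodic_support \<subseteq> L"
    unfolding ergodic_support_def using L by (intro closure_minimal) auto
next
  assume sub: "ergodic_support \<subseteq> L"
  show "states_vanish_off L"
    unfolding states_vanish_off_def
  proof (intro ballI allI impI)
    fix \<phi> and f :: "'k \<Rightarrow> real"
    assume \<phi>: "\<phi> \<in> invariant_states (act ` H)" and f: "continuous_on UNIV f"
      and pos: "\<forall>x. 0 \<le> f x" and fL: "\<forall>x\<in>L. f x = 0"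
    obtain \<mu> where \<mu>: "\<mu> \<in> ergodic_measures koopmans" "\<phi> f \<le> (LINT x|\<mu>. f x)"
      using ergodic_dominates[OF \<phi> f] by blast
    have "measure_support \<mu> \<subseteq> L"
      using \<mu>(1) sub closure_subset unfolding ergodic_support_def by blast
    then have "(LINT x|\<mu>. f x) = 0"
      using integral_zero_iff_support[OF K ergodicD(1)[OF \<mu>(1)] f] pos fL by blast
    moreover have "0 \<le> \<phi> f" using \<phi> f pos by (auto simp: invariant_states_def state_def)
    ultimately show "\<phi> f = 0" using \<mu>(2) by simp
  qed
qed

lemma center_iff:
  assumes F: "folner_sequence lam H F"
  shows "center_of_attraction lam F act L \<longleftrightarrow> closed L \<and> L \<noteq> {} \<and> ergodic_support \<subseteq> L"
  using center_imp_states_vanish[OF F, of L] states_vanish_imp_center[OF F, of L] states_vanish_iff[of L]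
  by (auto simp: center_of_attraction_def)

text \<open>A center must be nonempty, so the candidate for the smallest one needs an ergodic
  measure to exist. The Folner averages at any point have an invariant cluster state, and some
  ergodic measure dominates it.\<close>

lemma ergodic_support_nonempty:
  assumes F: "folner_sequence lam H F"
  shows "ergodic_support \<noteq> {}"
proof -
  obtain \<phi> where \<phi>: "\<phi> \<in> invariant_states (act ` H)"
    using cluster_state_exists[OF F filterlim_ident] by blast
  obtain \<mu> where \<mu>: "\<mu> \<in> ergodic_measures koopmans"
    using ergodic_dominates[OF \<phi> continuous_on_const] by blast
  have "measure_support \<mu> \<noteq> {}"
    using measure_support_props(2)[OF ergodicD(1)[OF \<mu>]] by auto
  then show ?thesis using \<mu> closure_subset unfolding ergodic_support_def by blast
qed

text \<open>Each primitive ideal consists of the functions vanishing on a support, and zero sets are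
  closed, so intersecting these ideals amounts to closing the union of the supports.\<close>

lemma radical_zero_eq: "radical_zero koopmans = vanishing_ideal ergodic_support"
proof -
  have "radical_zero koopmans = (\<Inter>\<mu>\<in>ergodic_measures koopmans. vanishing_ideal (measure_support \<mu>))"
    unfolding radical_zero_def Prim_def using measure_ideal_eq[OF K ergodicD(1)] by simp
  then show ?thesis by (simp add: Inter_vanishing_ideal ergodic_support_def)
qed

text \<open>The ergodic support is contained in every center and is one itself, so it is the least
  center; a least element is the only minimal one.\<close>

lemma minimal_center_iff:
  assumes F: "folner_sequence lam H F"
  shows "minimal_center_of_attraction lam F act M \<longleftrightarrow> M = ergodic_support"
proof -
  have "closed ergodic_support" by (simp add: ergodic_support_def)
  then have c: "center_of_attraction lam F act ergodic_support"
    using ergodic_support_nonempty[OF F] by (simp add: center_iff[OF F])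
  have le: "ergodic_support \<subseteq> L" if "center_of_attraction lam F act L" for L
    using that by (simp add: center_iff[OF F])
  show ?thesis
    unfolding minimal_center_of_attraction_def using c le by (metis subset_antisym)
qed

end

theorem theorem4p9:
  fixes H :: "'g::{topological_group_add, t2_space} set"
    and lam :: "'g measure"
    and act :: "'g \<Rightarrow> 'k::t2_space \<Rightarrow> 'k"
    and F :: "nat \<Rightarrow> 'g set"
  assumes "compact (UNIV :: 'k set)"
    and "locally_compact_space (euclidean :: 'g topology)"
    and "left_haar_measure lam"
    and "closed H"
    and "\<forall>s\<in>H. \<forall>t\<in>H. s + t \<in> H"
    and "continuous_semigroup_action H act"
    and "folner_sequence lam H F"
  shows "(\<forall>F'. folner_sequence lam H F' \<longrightarrow>
            (\<forall>L. center_of_attraction lam F act L \<longleftrightarrow> center_of_attraction lam F' act L)) \<and>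
         (\<forall>L. closed L \<and> L \<noteq> {} \<longrightarrow>
            (center_of_attraction lam F act L \<longleftrightarrow>
             vanishing_ideal L \<subseteq> radical_zero (koopman_semigroup H act))) \<and>
         (\<exists>!M. minimal_center_of_attraction lam F act M) \<and>
         (\<forall>M. minimal_center_of_attraction lam F act M \<longrightarrow>
            M = closure (\<Union>\<mu>\<in>ergodic_measures (koopman_semigroup H act). measure_support \<mu>) \<and>
            M = ideal_support (radical_zero (koopman_semigroup H act)))"
proof -
  interpret haar_action H lam act
    using assms(1,3,5,6) by unfold_locales auto
  note F = assms(7)
  have cl: "closed ergodic_support" by (simp add: ergodic_support_def)
  show ?thesis
  proof (intro conjI allI impI)
    fix F' L assume "folner_sequence lam H F'"
    then show "center_of_attraction lam F act L \<longleftrightarrow> center_of_attraction lam F' act L"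
      by (simp only: center_iff F)
  next
    \<comment> \<open>Both sides say that \<open>L\<close> contains the ergodic support: the left by
      \<open>center_iff\<close>, the right because inclusion of ideals reverses inclusion of
      sets.\<close>
    fix L :: "'k set" assume "closed L \<and> L \<noteq> {}"
    then show "center_of_attraction lam F act L \<longleftrightarrow> vanishing_ideal L \<subseteq> radical_zero (koopman_semigroup H act)"
      by (simp add: center_iff[OF F] radical_zero_eq vanishing_ideal_subset_iff[OF K])
  next
    show "\<exists>!M. minimal_center_of_attraction lam F act M"
      by (simp add: minimal_center_iff[OF F])
  next
    fix M assume "minimal_center_of_attraction lam F act M"
    then have M: "M = ergodic_support" by (simp add: minimal_center_iff[OF F])
    show "M = closure (\<Union>\<mu>\<in>ergodic_measures (koopman_semigroup H act). measure_support \<mu>)"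
      by (simp add: M ergodic_support_def)
    show "M = ideal_support (radical_zero (koopman_semigroup H act))"
      by (simp add: M radical_zero_eq ideal_support_vanishing_ideal[OF K cl])
  qed
qed

end
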